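(* Let $G=(V,E)$ be a DAG, $\Sigma$ a finite alphabet with $\sigma=|\Sigma|$, $\ell:V\to\Sigma$ a labeling function, $S\in\Sigma^m$ a string and $f_S$ its failure function. One can decide whether $S$ has a match in $G,\ell$ in time $O((|V|+|E|)w+\sigma m)$, where $w=|\{i\in\{0,\dots,m\}:\text{there is no } j \text{ with } f_S(j)=i\}|$.
   Context: A path is a sequence of distinct vertices joined consecutively by edges; its label is the concatenation of its vertex labels; $S$ has a match in $G,\ell$ if some path has label $S$. A border of a string is a segment that is simultaneously a proper prefix and a proper suffix (the empty string counts). The failure function $f_S:\{1,\dots,m\}\to\{0,\dots,m\}$ maps $i$ to the length of the longest border of $S[1..i]$. *)

theory Defs
  imports Main "HOL-Library.Sublist"
begin

section \<open>Strings\<close>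

definition border :: "'a list \<Rightarrow> 'a list \<Rightarrow> bool" where
  "border b s \<longleftrightarrow> strict_prefix b s \<and> strict_suffix b s"

text \<open>Only meaningful for \<open>1 \<le> i \<le> length S\<close>: then \<open>take i S\<close> is nonempty and
  has the empty border, so the maximum is over a nonempty finite set.\<close>

definition failure :: "'a list \<Rightarrow> nat \<Rightarrow> nat" where
  "failure S i = Max {length b | b. border b (take i S)}"

definition failure_width :: "'a list \<Rightarrow> nat" where
  "failure_width S =
     card {i \<in> {0..length S}. \<not> (\<exists>j \<in> {1..length S}. failure S j = i)}"


section \<open>Labelled DAGs\<close>

definition dag :: "'v set \<Rightarrow> ('v \<times> 'v) set \<Rightarrow> bool" where
  "dag V E \<longleftrightarrow> finite V \<and> E \<subseteq> V \<times> V \<and> acyclic E"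

definition path :: "'v set \<Rightarrow> ('v \<times> 'v) set \<Rightarrow> 'v list \<Rightarrow> bool" where
  "path V E p \<longleftrightarrow>
     set p \<subseteq> V \<and> distinct p \<and> successively (\<lambda>u v. (u, v) \<in> E) p"

definition has_match ::
    "'v set \<Rightarrow> ('v \<times> 'v) set \<Rightarrow> ('v \<Rightarrow> 'a) \<Rightarrow> 'a list \<Rightarrow> bool" where
  "has_match V E lab S \<longleftrightarrow> (\<exists>p. path V E p \<and> map lab p = S)"


section \<open>Word RAM\<close>

text \<open>
  A unit-cost random access machine whose words are the numbers below \<open>2 ^ W\<close>.
  A program is a fixed finite list of instructions, independent of \<open>W\<close>. Register
  operands are given by their (constant) register number; the memory is addressed
  indirectly through registers. Arithmetic is modulo \<open>2 ^ W\<close>, except that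
  subtraction is truncated at \<open>0\<close>.
\<close>

datatype instr =
    Const nat nat
  | Move nat nat
  | Add nat nat nat
  | Sub nat nat nat
  | Mult nat nat nat
  | Load nat nat
  | Store nat nat
  | Jump nat
  | JumpLess nat nat nat
  | Halt

record config =
  pc :: nat
  regs :: "nat \<Rightarrow> nat"
  mem :: "nat \<Rightarrow> nat"

definition set_reg :: "nat \<Rightarrow> nat \<Rightarrow> config \<Rightarrow> config" where
  "set_reg r x s = s\<lparr>pc := Suc (pc s), regs := (regs s)(r := x)\<rparr>"

fun exec_instr :: "nat \<Rightarrow> instr \<Rightarrow> config \<Rightarrow> config" where
  "exec_instr W (Const r n) s = set_reg r (n mod 2 ^ W) s"
| "exec_instr W (Move r a) s = set_reg r (regs s a) s"
| "exec_instr W (Add r a b) s = set_reg r ((regs s a + regs s b) mod 2 ^ W) s"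
| "exec_instr W (Sub r a b) s = set_reg r (regs s a - regs s b) s"
| "exec_instr W (Mult r a b) s = set_reg r ((regs s a * regs s b) mod 2 ^ W) s"
| "exec_instr W (Load r a) s = set_reg r (mem s (regs s a)) s"
| "exec_instr W (Store a r) s =
     s\<lparr>pc := Suc (pc s), mem := (mem s)(regs s a := regs s r)\<rparr>"
| "exec_instr W (Jump l) s = s\<lparr>pc := l\<rparr>"
| "exec_instr W (JumpLess a b l) s =
     s\<lparr>pc := (if regs s a < regs s b then l else Suc (pc s))\<rparr>"
| "exec_instr W Halt s = s"

definition halted :: "instr list \<Rightarrow> config \<Rightarrow> bool" where
  "halted P s \<longleftrightarrow> pc s \<ge> length P \<or> P ! pc s = Halt"

definition step :: "nat \<Rightarrow> instr list \<Rightarrow> config \<Rightarrow> config" where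
  "step W P s = (if halted P s then s else exec_instr W (P ! pc s) s)"

definition initial :: "nat list \<Rightarrow> config" where
  "initial xs =
     \<lparr>pc = 0, regs = (\<lambda>_. 0), mem = (\<lambda>i. if i < length xs then xs ! i else 0)\<rparr>"

text \<open>On input \<open>xs\<close> the program halts after at most \<open>T\<close> steps, with the answer
  \<open>b\<close> in register \<open>0\<close>.\<close>

definition answers_within ::
    "nat \<Rightarrow> instr list \<Rightarrow> nat list \<Rightarrow> bool \<Rightarrow> nat \<Rightarrow> bool" where
  "answers_within W P xs b T \<longleftrightarrow>
     (\<exists>t \<le> T. halted P ((step W P ^^ t) (initial xs)) \<and>
        regs ((step W P ^^ t) (initial xs)) 0 = (if b then 1 else 0))"


section \<open>Input encoding\<close>

definition listing :: "'a list \<Rightarrow> 'a set \<Rightarrow> bool" where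
  "listing xs A \<longleftrightarrow> distinct xs \<and> set xs = A"

definition position :: "'a list \<Rightarrow> 'a \<Rightarrow> nat" where
  "position xs x = (THE i. i < length xs \<and> xs ! i = x)"

text \<open>The vertices, edges and symbols are listed in an arbitrary order \<open>vs\<close>,
  \<open>es\<close>, \<open>as\<close>, and vertices and symbols are represented by their positions. The
  graph is given as a plain edge list; in particular neither the vertices nor the
  edges are assumed to be topologically sorted or grouped.\<close>

definition encode ::
    "'v list \<Rightarrow> ('v \<times> 'v) list \<Rightarrow> 'a list \<Rightarrow> ('v \<Rightarrow> 'a) \<Rightarrow> 'a list \<Rightarrow> nat list" where
  "encode vs es as lab S =
     [length vs, length es, length as, length S]
     @ map (\<lambda>v. position as (lab v)) vs
     @ concat (map (\<lambda>(u, v). [position vs u, position vs v]) es)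
     @ map (position as) S"

end

theory Submission
  imports Defs
begin

text \<open>
  For a vertex \<open>v\<close> let \<open>A v\<close> be the set of all \<open>i\<close> such that the prefix of \<open>S\<close> of length \<open>i\<close>
  labels a path ending in \<open>v\<close>, together with \<open>0\<close>. Suffixes of paths are paths, so \<open>A v\<close> is closed
  under the failure function, i.e. it is an ancestor-closed set of nodes of the tree in which
  the parent of \<open>i\<close> is \<open>f\<^sub>S(i)\<close>. This tree has \<open>w\<close> leaves and hence splits into \<open>w\<close> chains, and
  \<open>A v\<close> is determined by \<open>w\<close> numbers, one per chain. Along an edge \<open>(u, v)\<close> these numbers are
  propagated in time \<open>O(w)\<close> by the transition table of the Knuth-Morris-Pratt automaton, which
  is computed in time \<open>O(\<sigma> m)\<close>; the edges are handled in topological order by Kahn's algorithm.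

  The program is written in a small structured language that is compiled to the word RAM.
\<close>

section \<open>A structured language on the word RAM\<close>

text \<open>An ancestor-closed set meets a chain in an initial segment, so the deepest member on
  each chain determines it. Along one chain the suffix order agrees with \<open><\<close>, so adding
  a state to a set is a maximum in one slot. One transition per stored state suffices because
  transitions are monotone: if \<open>i\<close> is an ancestor of \<open>x\<close> and
  \<open>i\<close> can be extended by \<open>a\<close>, then \<open>Suc i\<close> is an ancestor of
  \<open>delta T x a\<close>. This is what lowers the cost of an edge from \<open>m\<close> to
  \<open>w\<close>. The price is that a row must be final before it is read, which the topological
  order guarantees. Acyclicity also makes every walk a path, so walks can be extended and cut
  freely. Rows are tied to reachability from two sides: \<open>row\<close> is soundness (each stored
  nonzero state is reached) and \<open>covers\<close> is completeness (each reached state is an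
  ancestor of a stored one). On the machine the obstacle is word size. All array indices stay below
  \<open>Q\<close>, a linear function of the sizes in the input header, and the two-dimensional
  arrays need addresses up to about the cube of \<open>Q\<close>; this dictates the polynomial lower
  bound on \<open>2 ^ W\<close>.\<close>

datatype var = Ans | NumV | NumE | NumA | Len | Ix | Fl | Sym | Slot | St | Wid
  | Src | Dst | Front | Back | Edge

datatype arr = Head | Next | Deg | Queue | Fail | Chain | Delta | Mark

datatype exp = Lit nat | Var var | Pls exp exp | Mns exp exp | Inp exp | Get arr exp exp

datatype com =
    Skip
  | Assign var exp (infix "::=" 61)
  | Put arr exp exp exp
  | Seq com com (infixr ";;" 60)
  | Cond exp exp com com
  | Loop exp exp com

text \<open>The clock \<open>tm\<close> counts assignments, array writes and tests; each of these
  takes at most as many machine steps as the whole program is long.\<close>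

record store =
  vr :: "var \<Rightarrow> nat"
  ar :: "arr \<Rightarrow> nat \<Rightarrow> nat \<Rightarrow> nat"
  tm :: nat

definition upd :: "var \<Rightarrow> nat \<Rightarrow> store \<Rightarrow> store" where
  "upd x n s = s\<lparr>vr := (vr s)(x := n), tm := Suc (tm s)\<rparr>"

definition put :: "arr \<Rightarrow> nat \<Rightarrow> nat \<Rightarrow> nat \<Rightarrow> store \<Rightarrow> store" where
  "put k i j n s = s\<lparr>ar := (ar s)(k := (ar s k)(i := (ar s k i)(j := n))), tm := Suc (tm s)\<rparr>"

definition tick :: "store \<Rightarrow> store" where
  "tick s = s\<lparr>tm := Suc (tm s)\<rparr>"

lemma upd_simps [simp]:
  "vr (upd x n s) = (vr s)(x := n)" "ar (upd x n s) = ar s" "tm (upd x n s) = Suc (tm s)"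
  by (simp_all add: upd_def)

lemma put_simps [simp]:
  "vr (put k i j n s) = vr s"
  "ar (put k i j n s) = (ar s)(k := (ar s k)(i := (ar s k i)(j := n)))"
  "tm (put k i j n s) = Suc (tm s)"
  by (simp_all add: put_def)

lemma tick_simps [simp]:
  "vr (tick s) = vr s" "ar (tick s) = ar s" "tm (tick s) = Suc (tm s)"
  by (simp_all add: tick_def)

text \<open>Variables live in the even registers, register 1 holds \<open>Q\<close>, and expressions are
  evaluated in the odd registers from 3 on.\<close>

fun reg :: "var \<Rightarrow> nat" where
  "reg Ans = 0" | "reg NumV = 2" | "reg NumE = 4" | "reg NumA = 6" | "reg Len = 8"
| "reg Ix = 10" | "reg Fl = 12" | "reg Sym = 14" | "reg Slot = 16" | "reg St = 18"
| "reg Wid = 20" | "reg Src = 22" | "reg Dst = 24" | "reg Front = 26" | "reg Back = 28"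
| "reg Edge = 30"

fun tag :: "arr \<Rightarrow> nat" where
  "tag Head = 0" | "tag Next = 1" | "tag Deg = 2" | "tag Queue = 3"
| "tag Fail = 4" | "tag Chain = 5" | "tag Delta = 6" | "tag Mark = 7"

lemma reg_eq_iff [simp]: "reg x = reg y \<longleftrightarrow> x = y"
  by (cases x; cases y; simp)

lemma even_reg [simp]: "even (reg x)"
  by (cases x; simp)

lemma tag_eq_iff [simp]: "tag k = tag l \<longleftrightarrow> k = l"
  by (cases k; cases l; simp)

lemma tag_less: "tag k < 8"
  by (cases k; simp)

text \<open>Horner evaluation of a base-\<open>Q\<close> address, with the indices in registers
  \<open>t\<close> and \<open>t + 2\<close> and \<open>Q\<close> in register 1. Once the second
  index is added, \<open>t + 2\<close> is free to hold the tag.\<close>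

definition addr_code :: "nat \<Rightarrow> arr \<Rightarrow> instr list" where
  "addr_code t k = [Mult t t 1, Add t t (t + 2), Mult t t 1, Const (t + 2) (tag k),
     Add t t (t + 2), Add t t 1]"

fun code :: "nat \<Rightarrow> exp \<Rightarrow> instr list" where
  "code t (Lit n) = [Const t n]"
| "code t (Var x) = [Move t (reg x)]"
| "code t (Pls a b) = code t a @ code (t + 2) b @ [Add t t (t + 2)]"
| "code t (Mns a b) = code t a @ code (t + 2) b @ [Sub t t (t + 2)]"
| "code t (Inp a) = code t a @ [Load t t]"
| "code t (Get k a b) = code t a @ code (t + 2) b @ addr_code t k @ [Load t t]"

text \<open>Jump targets are absolute, so \<open>p\<close> records where the emitted code will
  start. The else branch comes first because \<open>JumpLess\<close> leaves the straight line when
  the test succeeds.\<close>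

fun compile :: "nat \<Rightarrow> com \<Rightarrow> instr list" where
  "compile p Skip = []"
| "compile p (x ::= e) = code 3 e @ [Move (reg x) 3]"
| "compile p (Put k a b e) = code 3 a @ code 5 b @
addr_code 3 k @ code 5 e @ [Store 3 5]"
| "compile p (c ;; d) = compile p c @ compile (p + length (compile p c)) d"
| "compile p (Cond a b c d) =
     (let test = code 3 a @ code 5 b;
          d' = compile (p + length test + 1) d;
          q = p + length test + length d' + 2;
          c' = compile q c
      in test @ [JumpLess 3 5 q] @ d' @ [Jump (q + length c')] @ c')"
| "compile p (Loop a b c) =
     (let test = code 3 a @ code 5 b;
          q = p + length test + 2;
          c' = compile q c
      in test @ [JumpLess 3 5 q, Jump (q + length c' + 1)] @ c' @ [Jump p])"

section \<open>Straight-line code\<close>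

fun plain :: "instr \<Rightarrow> bool" where
  "plain (Jump l) = False" | "plain (JumpLess a b l) = False" | "plain Halt = False"
| "plain _ = True"

definition run :: "nat \<Rightarrow> instr list \<Rightarrow> config \<Rightarrow> config" where
  "run W is s = foldl (\<lambda>s i. exec_instr W i s) s is"

lemma run_simps [simp]:
  "run W [] s = s"
  "run W (i # is) s = run W is (exec_instr W i s)"
  "run W (is @ js) s = run W js (run W is s)"
  by (simp_all add: run_def)

lemma plain_pc: "plain i \<Longrightarrow> pc (exec_instr W i s) = Suc (pc s)"
  by (cases i) (auto simp: set_reg_def)

lemma pc_run: "list_all plain is \<Longrightarrow> pc (run W is s) = pc s + length is"
  by (induction "is" arbitrary: s) (auto simp: plain_pc)

lemma plain_steps:
  assumes "list_all plain is" "pc s = length pre"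
  shows "(step W (pre @ is @ post) ^^ length is) s = run W is s"
  using assms
proof (induction "is" arbitrary: pre s)
  case (Cons i "is")
  have "step W (pre @ (i # is) @ post) s = exec_instr W i s"
    using Cons.prems by (cases i) (auto simp: step_def halted_def nth_append)
  moreover have "(step W ((pre @ [i]) @ is @ post) ^^ length is) (exec_instr W i s)
      = run W is (exec_instr W i s)"
    using Cons.prems by (intro Cons.IH) (auto simp: plain_pc)
  ultimately show ?case
    by (simp add: funpow_Suc_right del: funpow.simps)
qed simp

lemma plain_addr_code [simp]: "list_all plain (addr_code t k)"
  by (simp add: addr_code_def)

lemma plain_code [simp]: "list_all plain (code t e)"
  by (induction e arbitrary: t) auto

text \<open>With \<open>8 <= Q\<close> every tag is a base-\<open>Q\<close> digit, so all addresses
  lie below \<open>Q * Q * Q + Q\<close>, and \<open>fits\<close> puts them within a word.\<close>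

locale machine =
  fixes W :: nat and Q :: nat and inp :: "nat \<Rightarrow> nat"
  assumes Q8: "8 \<le> Q" and fits: "Q * Q * Q + Q < 2 ^ W"
begin

section \<open>Cost semantics and correctness of the compiler\<close>

fun eval :: "exp \<Rightarrow> store \<Rightarrow> nat" where
  "eval (Lit n) s = n"
| "eval (Var x) s = vr s x"
| "eval (Pls a b) s = eval a s + eval b s"
| "eval (Mns a b) s = eval a s - eval b s"
| "eval (Inp a) s = inp (eval a s)"
| "eval (Get k a b) s = ar s k (eval a s) (eval b s)"

text \<open>Constants, sums and array indices stay below \<open>Q\<close>, so that no arithmetic wraps around.\<close>

fun safe :: "exp \<Rightarrow> store \<Rightarrow> bool" where
  "safe (Lit n) s \<longleftrightarrow> n < Q"
| "safe (Var x) s \<longleftrightarrow> True"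
| "safe (Pls a b) s \<longleftrightarrow> safe a s \<and> safe b s \<and> eval a s + eval b s < Q"
| "safe (Mns a b) s \<longleftrightarrow> safe a s \<and> safe b s"
| "safe (Inp a) s \<longleftrightarrow> safe a s \<and> eval a s < Q"
| "safe (Get k a b) s \<longleftrightarrow> safe a s \<and> safe b s \<and> eval a s < Q \<and> eval b s < Q"

text \<open>A derivation exists only for a terminating run in which every evaluated expression is
  \<open>safe\<close>, so termination and absence of overflow come with the result.\<close>

inductive exec :: "com \<Rightarrow> store \<Rightarrow> store \<Rightarrow> bool" where
  Skip: "exec Skip s s"
| Assign: "safe e s \<Longrightarrow> exec (x ::= e) s (upd x (eval e s) s)"
| Put: "safe a s \<Longrightarrow> safe b s \<Longrightarrow> safe e s \<Longrightarrow> eval a s < Q \<Longrightarrow> eval b s < Q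
    \<Longrightarrow> exec (Put k a b e) s (put k (eval a s) (eval b s) (eval e s) s)"
| Seq: "exec c s s' \<Longrightarrow> exec d s' s'' \<Longrightarrow> exec (c ;; d) s s''"
| CondT: "safe a s \<Longrightarrow> safe b s \<Longrightarrow> eval a s < eval b s \<Longrightarrow> exec c (tick s) s'
    \<Longrightarrow> exec (Cond a b c d) s s'"
| CondF: "safe a s \<Longrightarrow> safe b s \<Longrightarrow> \<not> eval a s < eval b s \<Longrightarrow> exec d (tick s) s'
    \<Longrightarrow> exec (Cond a b c d) s s'"
| LoopT: "safe a s \<Longrightarrow> safe b s \<Longrightarrow> eval a s < eval b s \<Longrightarrow> exec c (tick s) s'
    \<Longrightarrow> exec (Loop a b c) s' s'' \<Longrightarrow> exec (Loop a b c) s s''"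
| LoopF: "safe a s \<Longrightarrow> safe b s \<Longrightarrow> \<not> eval a s < eval b s \<Longrightarrow> exec (Loop a b c) s (tick s)"

text \<open>Each array entry has a three-digit address in base \<open>Q\<close>, beyond the input.\<close>

definition addr :: "arr \<Rightarrow> nat \<Rightarrow> nat \<Rightarrow> nat" where
  "addr k i j = (i * Q + j) * Q + tag k + Q"

text \<open>The program counter, the clock and the odd registers other than 1 are left open; hence
  jumps and the evaluation of expressions preserve the relation.\<close>

definition represents :: "config \<Rightarrow> store \<Rightarrow> bool" where
  "represents f s \<longleftrightarrow> (\<forall>x. regs f (reg x) = vr s x) \<and> regs f 1 = Q
     \<and> (\<forall>k i j. i < Q \<longrightarrow> j < Q \<longrightarrow> mem f (addr k i j) = ar s k i j)
     \<and> (\<forall>a < Q. mem f a = inp a)"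

lemma digits_inject:
  assumes "(i * Q + j :: nat) = i' * Q + j'" "j < Q" "j' < Q"
  shows "i = i'" "j = j'"
proof -
  have "(i * Q + j) div Q = (i' * Q + j') div Q" "(i * Q + j) mod Q = (i' * Q + j') mod Q"
    using assms by auto
  then show "i = i'" "j = j'"
    using assms(2,3) by auto
qed

lemma addr_inject:
  assumes "addr k i j = addr k' i' j'" "j < Q" "j' < Q"
  shows "k = k' \<and> i = i' \<and> j = j'"
proof -
  have t: "tag k < Q" "tag k' < Q"
    using tag_less[of k] tag_less[of k'] Q8 by linarith+
  have e: "(i * Q + j) * Q + tag k = (i' * Q + j') * Q + tag k'"
    using assms(1) by (simp add: addr_def)
  show ?thesis
    using digits_inject[OF e t] digits_inject[of i j i' j'] assms(2,3) by simp
qed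

lemma addr_ge: "Q \<le> addr k i j"
  by (simp add: addr_def)

text \<open>Every partial result of the Horner scheme is bounded, so the reductions modulo
  \<open>2 ^ W\<close> inside \<open>addr_code\<close> have no effect.\<close>

lemma addr_bounds:
  assumes "i < Q" "j < Q"
  shows "i * Q < 2 ^ W" "i * Q + j < 2 ^ W" "(i * Q + j) * Q < 2 ^ W"
    "(i * Q + j) * Q + tag k < 2 ^ W" "addr k i j < 2 ^ W" "tag k < 2 ^ W"
proof -
  have "Suc i * Q \<le> Q * Q"
    using assms by (intro mult_right_mono) auto
  then have "Suc (i * Q + j) \<le> Q * Q"
    using assms by simp
  then have "Suc (i * Q + j) * Q \<le> Q * Q * Q"
    by (intro mult_right_mono) auto
  then have 1: "(i * Q + j) * Q + Q \<le> Q * Q * Q"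
    by simp
  have 2: "tag k < Q"
    using tag_less[of k] Q8 by linarith
  have "(i * Q + j) * 1 \<le> (i * Q + j) * Q"
    using Q8 by (intro mult_left_mono) auto
  then have 3: "i * Q + j \<le> (i * Q + j) * Q"
    by simp
  show "addr k i j < 2 ^ W" "(i * Q + j) * Q + tag k < 2 ^ W" "(i * Q + j) * Q < 2 ^ W"
    "i * Q + j < 2 ^ W" "i * Q < 2 ^ W" "tag k < 2 ^ W"
    using 1 2 3 fits unfolding addr_def by linarith+
qed

lemma Q_fits: "n < Q \<Longrightarrow> n < 2 ^ W"
  using fits by linarith

lemma run_addr_code:
  assumes "regs f t = i" "regs f (t + 2) = j" "regs f 1 = Q" "i < Q" "j < Q" "1 < t"
  shows "regs (run W (addr_code t k) f) t = addr k i j"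
    "r \<noteq> t \<Longrightarrow> r \<noteq> t + 2 \<Longrightarrow> regs (run W (addr_code t k) f) r = regs f r"
    "mem (run W (addr_code t k) f) = mem f"
proof -
  note bd = addr_bounds(1-3)[OF assms(4,5)] addr_bounds(4-6)[OF assms(4,5), of k]
  have "t \<noteq> 1" "1 \<noteq> t" "Suc 0 \<noteq> t"
    using assms(6) by auto
  then show "regs (run W (addr_code t k) f) t = addr k i j"
    using assms(1-3) bd by (simp add: addr_code_def set_reg_def addr_def)
  show "mem (run W (addr_code t k) f) = mem f"
    by (simp add: addr_code_def set_reg_def)
  show "regs (run W (addr_code t k) f) r = regs f r" if "r \<noteq> t" "r \<noteq> t + 2"
    using that by (simp add: addr_code_def set_reg_def)
qed

text \<open>The third claim carries the induction: the right operand is evaluated from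
  \<open>t + 2\<close> on, so it cannot disturb the left operand waiting in \<open>t\<close>, nor
  \<open>Q\<close> in register 1.\<close>

lemma run_code:
  assumes "represents f s" "safe e s" "odd t" "1 < t"
  shows "regs (run W (code t e) f) t = eval e s" (is "?v f t e")
    "mem (run W (code t e) f) = mem f" (is "?m f t e")
    "\<forall>r. even r \<or> r < t \<longrightarrow> regs (run W (code t e) f) r = regs f r" (is "?r f t e")
proof -
  have "?v f t e \<and> ?m f t e \<and> ?r f t e"
    using assms
  proof (induction e arbitrary: f t)
    case (Lit n)
    then show ?case by (auto simp: set_reg_def Q_fits)
  next
    case (Var x)
    then show ?case by (auto simp: set_reg_def represents_def)
  next
    case (Inp a)
    have "?v f t a \<and> ?m f t a \<and> ?r f t a"
      using Inp by auto
    with Inp.prems show ?case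
      by (auto simp: set_reg_def represents_def)
  next
    case (Pls a b)
    define g where "g = run W (code t a) f"
    have a: "?v f t a" "?m f t a" "?r f t a"
      using Pls.IH(1)[of f t] Pls.prems by auto
    have "represents g s"
      using a Pls.prems unfolding represents_def g_def by auto
    then have b: "?v g (t + 2) b" "?m g (t + 2) b" "?r g (t + 2) b"
      using Pls.IH(2)[of g "t + 2"] Pls.prems by auto
    have "regs (run W (code (t + 2) b) g) t = eval a s"
      using a b g_def by auto
    with a b Pls.prems Q_fits show ?case
      by (auto simp: set_reg_def g_def[symmetric])
  next
    case (Mns a b)
    define g where "g = run W (code t a) f"
    have a: "?v f t a" "?m f t a" "?r f t a"
      using Mns.IH(1)[of f t] Mns.prems by auto
    have "represents g s"
      using a Mns.prems unfolding represents_def g_def by auto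
    then have b: "?v g (t + 2) b" "?m g (t + 2) b" "?r g (t + 2) b"
      using Mns.IH(2)[of g "t + 2"] Mns.prems by auto
    have "regs (run W (code (t + 2) b) g) t = eval a s"
      using a b g_def by auto
    with a b Mns.prems show ?case
      by (auto simp: set_reg_def g_def[symmetric])
  next
    case (Get k a b)
    define g where "g = run W (code t a) f"
    define h where "h = run W (code (t + 2) b) g"
    have a: "?v f t a" "?m f t a" "?r f t a"
      using Get.IH(1)[of f t] Get.prems by auto
    have "represents g s"
      using a Get.prems unfolding represents_def g_def by auto
    then have b: "?v g (t + 2) b" "?m g (t + 2) b" "?r g (t + 2) b"
      using Get.IH(2)[of g "t + 2"] Get.prems by auto
    have h: "regs h t = eval a s" "regs h (t + 2) = eval b s" "regs h 1 = Q" "mem h = mem f"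
      "\<forall>r. even r \<or> r < t \<longrightarrow> regs h r = regs f r"
      using a b Get.prems by (auto simp: g_def h_def represents_def)
    have l: "eval a s < Q" "eval b s < Q"
      using Get.prems by auto
    note ad = run_addr_code[OF h(1-3) l Get.prems(4), where k = k]
    have "mem f (addr k (eval a s) (eval b s)) = ar s k (eval a s) (eval b s)"
      using Get.prems l by (auto simp: represents_def)
    moreover have "\<forall>r. even r \<or> r < t \<longrightarrow> r \<noteq> t \<and> r \<noteq> t + 2"
      using Get.prems(3) by auto
    moreover have "run W (code t (Get k a b)) f = exec_instr W (Load t t) (run W (addr_code t k) h)"
      by (simp add: g_def h_def)
    ultimately show ?case
      using ad h(4,5) by (simp add: set_reg_def)
  qed
  then show "?v f t e" "?m f t e" "?r f t e" by auto
qed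

lemma represents_code:
  assumes "represents f s" "safe e s" "odd t" "1 < t"
  shows "represents (run W (code t e) f) s"
  using run_code[OF assms] assms unfolding represents_def by auto

lemma represents_simps:
  "represents (f\<lparr>pc := p\<rparr>) s = represents f s"
  "represents f (tick s) = represents f s"
  by (simp_all add: represents_def)

lemma run_test:
  assumes "represents f s" "safe a s" "safe b s"
  shows "regs (run W (code 3 a @ code 5 b) f) 3 = eval a s"
    "regs (run W (code 3 a @ code 5 b) f) 5 = eval b s"
    "represents (run W (code 3 a @ code 5 b) f) s"
proof -
  have g: "represents (run W (code 3 a) f) s"
    using assms by (simp add: represents_code)
  show "regs (run W (code 3 a @ code 5 b) f) 3 = eval a s"
    "regs (run W (code 3 a @ code 5 b) f) 5 = eval b s"
    "represents (run W (code 3 a @ code 5 b) f) s"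
    using run_code[OF assms(1,2), of 3] run_code[OF g assms(3), of 5] represents_code[OF g assms(3)]
    by auto
qed

lemma represents_assign:
  assumes "represents f s" "safe e s"
  shows "represents (run W (code 3 e @ [Move (reg x) 3]) f) (upd x (eval e s) s)"
proof -
  have 1: "(reg x = 1) = False"
    using even_reg[of x] by (metis odd_one)
  show ?thesis
    using run_code[OF assms, of 3] represents_code[OF assms, of 3] 1
    by (auto simp: represents_def set_reg_def simp del: even_reg)
qed

text \<open>The address is complete in register 3 before the value is evaluated in register 5, and
  code for register 5 leaves lower registers alone. Injectivity of \<open>addr\<close> confines the
  write to one entry, and addresses from \<open>Q\<close> on spare the input.\<close>

lemma represents_put:
  assumes "represents f s" "safe a s" "safe b s" "safe e s" "eval a s < Q" "eval b s < Q"
  shows "represents (run W (code 3 a @ code 5 b @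
addr_code 3 k @ code 5 e @ [Store 3 5]) f) (put k (eval a s) (eval b s) (eval e s) s)"
proof -
  define g where "g = run W (code 3 a @ code 5 b) f"
  have g: "regs g 3 = eval a s" "regs g 5 = eval b s" "represents g s"
    unfolding g_def using run_test[OF assms(1-3)] by blast+
  define h where "h = run W (addr_code 3 k) g"
  have odds: "reg x \<noteq> 3" "reg x \<noteq> 5" "reg x \<noteq> 1" for x
    using even_reg[of x] by (auto simp del: even_reg)
  have "regs g 1 = Q"
    using g by (simp add: represents_def)
  then have ad: "regs h 3 = addr k (eval a s) (eval b s)" "mem h = mem g"
      "\<And>r. r \<noteq> 3 \<Longrightarrow> r \<noteq> 5 \<Longrightarrow> regs h r = regs g r"
    using run_addr_code[of g 3, OF g(1) _ _ assms(5,6)] g(2) by (auto simp: h_def)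
  then have h: "represents h s" "regs h 3 = addr k (eval a s) (eval b s)"
    using g(3) odds by (auto simp: represents_def)
  define i where "i = run W (code 5 e) h"
  have i: "represents i s" "regs i 5 = eval e s" "regs i 3 = addr k (eval a s) (eval b s)"
    using run_code[OF h(1) assms(4), of 5] represents_code[OF h(1) assms(4), of 5] h(2)
    by (auto simp: i_def)
  have "represents (run W [Store 3 5] i) (put k (eval a s) (eval b s) (eval e s) s)"
    unfolding represents_def
  proof (intro conjI allI impI)
    fix l i' j' assume l: "i' < Q" "j' < Q"
    show "mem (run W [Store 3 5] i) (addr l i' j')
        = ar (put k (eval a s) (eval b s) (eval e s) s) l i' j'"
      using addr_inject[of l i' j' k "eval a s" "eval b s"] l i assms(6)
      by (auto simp: represents_def)
  next
    fix d assume "d < Q"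
    then show "mem (run W [Store 3 5] i) d = inp d"
      using i addr_ge[of k "eval a s" "eval b s"] by (auto simp: represents_def)
  qed (use i in \<open>auto simp: represents_def\<close>)
  then show ?thesis
    by (simp add: i_def h_def g_def)
qed

text \<open>The clock acts as a potential: one tick pays for \<open>length P\<close> machine steps.
  Stated additively, the bound composes without subtraction.\<close>

definition simulates :: "instr list \<Rightarrow> nat \<Rightarrow> nat \<Rightarrow> store \<Rightarrow> store \<Rightarrow> bool" where
  "simulates P p q s s' \<longleftrightarrow> (\<forall>f. represents f s \<longrightarrow> pc f = p \<longrightarrow>
     (\<exists>t. represents ((step W P ^^ t) f) s' \<and> pc ((step W P ^^ t) f) = q
        \<and> t + length P * tm s \<le> length P * tm s'))"

lemma simulatesI:
  assumes "\<And>f. represents f s \<Longrightarrow> pc f = p \<Longrightarrow>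
     \<exists>t. represents ((step W P ^^ t) f) s' \<and> pc ((step W P ^^ t) f) = q
        \<and> t + length P * tm s \<le> length P * tm s'"
  shows "simulates P p q s s'"
  using assms by (simp add: simulates_def)

lemma simulates_trans:
  assumes "simulates P p q s s'" "simulates P q r s' s''"
  shows "simulates P p r s s''"
proof (rule simulatesI)
  fix f assume f: "represents f s" "pc f = p"
  then obtain t where t: "represents ((step W P ^^ t) f) s'" "pc ((step W P ^^ t) f) = q"
      "t + length P * tm s \<le> length P * tm s'"
    using assms(1) unfolding simulates_def by blast
  then obtain t' where t': "represents ((step W P ^^ t') ((step W P ^^ t) f)) s''"
      "pc ((step W P ^^ t') ((step W P ^^ t) f)) = r" "t' + length P * tm s' \<le> length P * tm s''"
    using assms(2) unfolding simulates_def by blast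
  have "(step W P ^^ (t' + t)) f = (step W P ^^ t') ((step W P ^^ t) f)"
    by (simp add: funpow_add)
  with t t' show "\<exists>t. represents ((step W P ^^ t) f) s'' \<and> pc ((step W P ^^ t) f) = r
      \<and> t + length P * tm s \<le> length P * tm s''"
    by (intro exI[of _ "t' + t"]) auto
qed

lemma plain_simulates:
  assumes "P = pre @ is @ post" "list_all plain is" "\<And>f. represents f s \<Longrightarrow> represents (run W is f) s'"
    "tm s' = Suc (tm s)"
  shows "simulates P (length pre) (length pre + length is) s s'"
proof (rule simulatesI)
  fix f assume "represents f s" "pc f = length pre"
  then show "\<exists>t. represents ((step W P ^^ t) f) s' \<and> pc ((step W P ^^ t) f) = length pre + length is
      \<and> t + length P * tm s \<le> length P * tm s'"
    using assms plain_steps[of "is" f pre W post]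
    by (intro exI[of _ "length is"]) (auto simp: pc_run)
qed

lemma step_at:
  assumes "pc f = length pre" "i \<noteq> Halt"
  shows "step W (pre @ i # post) f = exec_instr W i f"
  using assms by (auto simp: step_def halted_def)

lemma test_simulates:
  assumes "P = pre @ code 3 a @ code 5 b @ JumpLess 3 5 q # post" "safe a s" "safe b s"
    "represents f s" "pc f = length pre"
  shows "\<exists>g. (step W P ^^ (length (code 3 a @ code 5 b) + 1)) f = g \<and> represents g s \<and>
    pc g = (if eval a s < eval b s then q else length (pre @ code 3 a @ code 5 b) + 1)"
proof -
  let ?c = "code 3 a @ code 5 b"
  let ?g = "run W ?c f"
  have g: "(step W P ^^ length ?c) f = ?g"
    using plain_steps[of ?c f pre W "JumpLess 3 5 q # post"] assms by simp
  have p: "pc ?g = length (pre @ ?c)"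
    using assms by (simp add: pc_run)
  have "step W P ?g = exec_instr W (JumpLess 3 5 q) ?g"
    using step_at[OF p, of "JumpLess 3 5 q" post] assms(1) by simp
  then show ?thesis
    using run_test[OF assms(4,2,3)] g p by (auto simp: represents_simps)
qed

text \<open>Induction on the derivation rather than on the command, so that a loop may run the same
  code block repeatedly. \<open>pre\<close> and \<open>post\<close> stay arbitrary because
  subcommands sit at other offsets of the same program.\<close>

lemma compile_correct:
  assumes "exec c s s'" "P = pre @ compile (length pre) c @ post"
  shows "simulates P (length pre) (length (pre @ compile (length pre) c)) s s'"
  using assms
proof (induction arbitrary: pre post rule: exec.induct)
  case (Skip s)
  show ?case
    by (rule simulatesI) (auto intro!: exI[of _ 0])
next
  case (Assign e s x)
  then show ?case
    using plain_simulates[of P pre "code 3 e @ [Move (reg x) 3]" post s "upd x (eval e s) s"]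
      represents_assign by auto
next
  case (Put a s b e k)
  then show ?case
    using plain_simulates[of P pre "compile (length pre) (Put k a b e)" post s
        "put k (eval a s) (eval b s) (eval e s) s"]
      represents_put[of _ s a b e k] by auto
next
  case (Seq c s s' d s'')
  show ?case
    using simulates_trans[OF Seq.IH(1)[of pre] Seq.IH(2)[of "pre @ compile (length pre) c"]]
      Seq.prems by (auto simp: add.assoc)
next
  case (CondT a s b c s' d)
  define test d' where "test = code 3 a @ code 5 b"
    and "d' = compile (length pre + length test + 1) d"
  define q where "q = length pre + length test + length d' + 2"
  define c' where "c' = compile q c"
  have P: "P = pre @ test @ JumpLess 3 5 q # d' @ Jump (q + length c') # c' @ post"
    using CondT.prems by (simp add: test_def d'_def q_def c'_def Let_def add.assoc)
  let ?pre = "pre @ test @ JumpLess 3 5 q # d' @ [Jump (q + length c')]"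
  have l: "length ?pre = q"
    by (simp add: q_def)
  have "simulates P (length pre) q s (tick s)"
  proof (rule simulatesI)
    fix f assume f: "represents f s" "pc f = length pre"
    then obtain g where "(step W P ^^ (length test + 1)) f = g" "represents g s" "pc g = q"
      using test_simulates[of P pre a b q "d' @ Jump (q + length c') # c' @ post" s f] P CondT.hyps
      by (auto simp: test_def)
    then show "\<exists>t. represents ((step W P ^^ t) f) (tick s) \<and> pc ((step W P ^^ t) f) = q
      \<and> t + length P * tm s \<le> length P * tm (tick s)"
      by (intro exI[of _ "length test + 1"]) (auto simp: represents_simps P)
  qed
  moreover have "simulates P q (q + length c') (tick s) s'"
    using CondT.IH[of ?pre post] unfolding l length_append[of ?pre] c'_def[symmetric] by (simp add: P)
  ultimately show ?case
    using simulates_trans by (auto simp: test_def d'_def q_def c'_def Let_def add_ac)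
next
  case (CondF a s b d s' c)
  define test d' where "test = code 3 a @ code 5 b"
    and "d' = compile (length pre + length test + 1) d"
  define q where "q = length pre + length test + length d' + 2"
  define c' where "c' = compile q c"
  have P: "P = pre @ test @ JumpLess 3 5 q # d' @ Jump (q + length c') # c' @ post"
    using CondF.prems by (simp add: test_def d'_def q_def c'_def Let_def add.assoc)
  let ?pre = "pre @ test @ [JumpLess 3 5 q]"
  have d: "simulates P (length ?pre) (length (?pre @ d')) (tick s) s'"
    using CondF.IH[of ?pre "Jump (q + length c') # c' @ post"] by (simp add: P d'_def)
  have "simulates P (length pre) (q + length c') s s'"
  proof (rule simulatesI)
    fix f assume f: "represents f s" "pc f = length pre"
    then obtain g where g: "(step W P ^^ (length test + 1)) f = g" "represents g s"
        "pc g = length ?pre"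
      using test_simulates[of P pre a b q "d' @ Jump (q + length c') # c' @ post" s f] P CondF.hyps
      by (auto simp: test_def)
    then obtain t where t: "represents ((step W P ^^ t) g) s'"
        "pc ((step W P ^^ t) g) = length (?pre @ d')" "t + length P * tm (tick s) \<le> length P * tm s'"
      using d by (auto simp: simulates_def represents_simps)
    have "step W P ((step W P ^^ t) g) = ((step W P ^^ t) g)\<lparr>pc := q + length c'\<rparr>"
      using step_at[OF t(2), of "Jump (q + length c')" "c' @ post"] by (simp add: P)
    moreover have "(step W P ^^ (Suc (t + (length test + 1)))) f = step W P ((step W P ^^ t) g)"
      by (simp only: funpow.simps funpow_add[of t "length test + 1"] o_apply g(1))
    \<comment> \<open>The tick of the test must also pay for the final \<open>Jump\<close> over the
      other branch.\<close>
    moreover have "length test + 2 \<le> length P"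
      by (simp add: P)
    ultimately show "\<exists>t. represents ((step W P ^^ t) f) s' \<and> pc ((step W P ^^ t) f) = q + length c'
      \<and> t + length P * tm s \<le> length P * tm s'"
      using t by (intro exI[of _ "Suc (t + (length test + 1))"])
        (auto simp: represents_simps simp del: funpow.simps)
  qed
  then show ?case
    by (auto simp: test_def d'_def q_def c'_def Let_def add_ac)
next
  case (LoopT a s b c s' s'')
  define test where "test = code 3 a @ code 5 b"
  define q where "q = length pre + length test + 2"
  define c' where "c' = compile q c"
  have P: "P = pre @ test @ JumpLess 3 5 q # Jump (q + length c' + 1) # c' @ Jump (length pre) # post"
    using LoopT.prems by (simp add: test_def q_def c'_def Let_def add.assoc)
  let ?pre = "pre @ test @ [JumpLess 3 5 q, Jump (q + length c' + 1)]"
  have l: "length ?pre = q"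
    by (simp add: q_def)
  have c: "simulates P q (length (?pre @ c')) (tick s) s'"
    using LoopT.IH(1)[of ?pre "Jump (length pre) # post"] unfolding l c'_def[symmetric]
    by (simp add: P)
  have "simulates P (length pre) (length pre) s s'"
  proof (rule simulatesI)
    fix f assume f: "represents f s" "pc f = length pre"
    then obtain g where g: "(step W P ^^ (length test + 1)) f = g" "represents g s" "pc g = q"
      using test_simulates[of P pre a b q "Jump (q + length c' + 1) # c' @ Jump (length pre) # post" s f]
        P LoopT.hyps by (auto simp: test_def)
    then obtain t where t: "represents ((step W P ^^ t) g) s'"
        "pc ((step W P ^^ t) g) = length (?pre @ c')" "t + length P * tm (tick s) \<le> length P * tm s'"
      using c by (auto simp: simulates_def represents_simps)
    have "step W P ((step W P ^^ t) g) = ((step W P ^^ t) g)\<lparr>pc := length pre\<rparr>"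
      using step_at[OF t(2), of "Jump (length pre)" post] by (simp add: P)
    moreover have "(step W P ^^ (Suc (t + (length test + 1)))) f = step W P ((step W P ^^ t) g)"
      by (simp only: funpow.simps funpow_add[of t "length test + 1"] o_apply g(1))
    moreover have "length test + 2 \<le> length P"
      by (simp add: P)
    ultimately show "\<exists>t. represents ((step W P ^^ t) f) s' \<and> pc ((step W P ^^ t) f) = length pre
      \<and> t + length P * tm s \<le> length P * tm s'"
      using t by (intro exI[of _ "Suc (t + (length test + 1))"])
        (auto simp: represents_simps simp del: funpow.simps)
  qed
  then show ?case
    \<comment> \<open>The jump back leads to the start of the loop, where the remaining iterations
      use the identical code block.\<close>
    using LoopT.IH(2)[OF LoopT.prems] by (rule simulates_trans)
next
  case (LoopF a s b c)
  define test where "test = code 3 a @ code 5 b"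
  define q where "q = length pre + length test + 2"
  define c' where "c' = compile q c"
  have P: "P = pre @ test @ JumpLess 3 5 q # Jump (q + length c' + 1) # c' @ Jump (length pre) # post"
    using LoopF.prems by (simp add: test_def q_def c'_def Let_def add.assoc)
  have "simulates P (length pre) (q + length c' + 1) s (tick s)"
  proof (rule simulatesI)
    fix f assume f: "represents f s" "pc f = length pre"
    let ?pre = "pre @ test @ [JumpLess 3 5 q]"
    obtain g where g: "(step W P ^^ (length test + 1)) f = g" "represents g s"
        "pc g = length ?pre"
      using test_simulates[of P pre a b q "Jump (q + length c' + 1) # c' @ Jump (length pre) # post" s f]
        P LoopF.hyps f by (auto simp: test_def)
    have "step W P g = g\<lparr>pc := q + length c' + 1\<rparr>"
      using step_at[OF g(3), of "Jump (q + length c' + 1)" "c' @ Jump (length pre) # post"]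
      by (simp add: P)
    moreover have "(step W P ^^ (Suc (length test + 1))) f = step W P g"
      by (simp only: funpow.simps o_apply g(1))
    moreover have "length test + 2 \<le> length P"
      by (simp add: P)
    ultimately show "\<exists>t. represents ((step W P ^^ t) f) (tick s)
      \<and> pc ((step W P ^^ t) f) = q + length c' + 1 \<and> t + length P * tm s \<le> length P * tm (tick s)"
      using g by (intro exI[of _ "Suc (length test + 1)"])
        (auto simp: represents_simps simp del: funpow.simps)
  qed
  then show ?case
    by (simp add: test_def q_def c'_def Let_def add_ac)
qed

end

text \<open>Computes \<open>Q\<close> into register 1 as
  \<open>|V| + 2 |E| + |Sigma| + m + 8\<close> from the four header words, touching only registers 1
  and 3. The first \<open>Load\<close> reads cell 0 because registers start at 0.\<close>

definition prelude :: "instr list" where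
  "prelude =
     [Load 1 1, Const 3 1, Load 3 3, Add 1 1 3, Add 1 1 3, Const 3 2, Load 3 3, Add 1 1 3,
      Const 3 3, Load 3 3, Add 1 1 3, Const 3 8, Add 1 1 3]"

definition program :: "com \<Rightarrow> instr list" where
  "program c = prelude @ compile (length prelude) c"

definition blank :: store where
  "blank = \<lparr>vr = \<lambda>_. 0, ar = \<lambda>_ _ _. 0, tm = 0\<rparr>"

fun written_vars :: "com \<Rightarrow> var set" where
  "written_vars Skip = {}"
| "written_vars (x ::= e) = {x}"
| "written_vars (Put k a b e) = {}"
| "written_vars (c ;; d) = written_vars c \<union> written_vars d"
| "written_vars (Cond a b c d) = written_vars c \<union> written_vars d"
| "written_vars (Loop a b c) = written_vars c"

fun written_arrs :: "com \<Rightarrow> arr set" where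
  "written_arrs Skip = {}"
| "written_arrs (x ::= e) = {}"
| "written_arrs (Put k a b e) = {k}"
| "written_arrs (c ;; d) = written_arrs c \<union> written_arrs d"
| "written_arrs (Cond a b c d) = written_arrs c \<union> written_arrs d"
| "written_arrs (Loop a b c) = written_arrs c"

text \<open>A syntactic over-approximation of what a command changes; it lets loop invariants speak
  only of what the loop body modifies.\<close>

definition frame :: "com \<Rightarrow> store \<Rightarrow> store \<Rightarrow> bool" where
  "frame c s s' \<longleftrightarrow> (\<forall>x. x \<notin> written_vars c \<longrightarrow> vr s' x = vr s x)
     \<and> (\<forall>k. k \<notin> written_arrs c \<longrightarrow> ar s' k = ar s k)"

lemma frame_vr: "frame c s s' \<Longrightarrow> x \<notin> written_vars c \<Longrightarrow> vr s' x = vr s x"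
  and frame_ar: "frame c s s' \<Longrightarrow> k \<notin> written_arrs c \<Longrightarrow> ar s' k = ar s k"
  by (auto simp: frame_def)

lemma frame_refl [simp]: "frame c s s"
  by (simp add: frame_def)

lemma frame_tick [simp]: "frame c (tick s) s' = frame c s s'" "frame c s (tick s') = frame c s s'"
  by (simp_all add: frame_def)

lemma frame_trans: "frame c s s' \<Longrightarrow> frame c s' s'' \<Longrightarrow> frame c s s''"
  by (simp add: frame_def)

section \<open>Weakest preconditions and the complete program\<close>

context machine
begin

lemma exec_frame: "exec c s s' \<Longrightarrow> frame c s s'"
  by (induction rule: exec.induct) (auto simp: frame_def)

definition wp :: "com \<Rightarrow> (store \<Rightarrow> bool) \<Rightarrow> store \<Rightarrow> bool" where
  "wp c P s \<longleftrightarrow> (\<exists>s'. exec c s s' \<and> P s')"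

inductive_cases exec_elims:
  "exec Skip s s'"
  "exec (x ::= e) s s'"
  "exec (Put k a b e) s s'"
  "exec (c ;; d) s s'"
  "exec (Cond a b c d) s s'"

lemma wp_simps [simp]:
  "wp Skip P s \<longleftrightarrow> P s"
  "wp (x ::= e) P s \<longleftrightarrow> safe e s \<and> P (upd x (eval e s) s)"
  "wp (Put k a b e) P s \<longleftrightarrow> safe a s \<and> safe b s \<and> safe e s \<and> eval a s < Q \<and> eval b s < Q
     \<and> P (put k (eval a s) (eval b s) (eval e s) s)"
  "wp (c ;; d) P s \<longleftrightarrow> wp c (wp d P) s"
  "wp (Cond a b c d) P s \<longleftrightarrow> safe a s \<and> safe b s
     \<and> (if eval a s < eval b s then wp c P (tick s) else wp d P (tick s))"
  unfolding wp_def by (auto elim!: exec_elims intro: exec.intros)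

lemma wp_mono: "wp c P s \<Longrightarrow> (\<And>s'. P s' \<Longrightarrow> frame c s s' \<Longrightarrow> P' s') \<Longrightarrow> wp c P' s"
  unfolding wp_def using exec_frame by blast

text \<open>Besides the invariant, the frame relative to the entry state \<open>s0\<close> is
  available in every obligation. The failing test costs a tick too, hence \<open>P (tick s)\<close>
  on exit.\<close>

lemma wp_Loop:
  assumes "I s0"
    and safe: "\<And>s. I s \<Longrightarrow> frame c s0 s \<Longrightarrow> safe a s \<and> safe b s"
    and body: "\<And>s. I s \<Longrightarrow> frame c s0 s \<Longrightarrow> eval a s < eval b s \<Longrightarrow>
      wp c (\<lambda>s'. I s' \<and> (\<mu> s' :: nat) < \<mu> s) (tick s)"
    and exit: "\<And>s. I s \<Longrightarrow> frame c s0 s \<Longrightarrow> \<not> eval a s < eval b s \<Longrightarrow> P (tick s)"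
  shows "wp (Loop a b c) P s0"
proof -
  have "wp (Loop a b c) P s" if "I s" "frame c s0 s" for s
    using that
  proof (induction "\<mu> s" arbitrary: s rule: less_induct)
    case less
    note sf = safe[OF less.prems]
    show ?case
    proof (cases "eval a s < eval b s")
      case True
      then obtain s' where s': "exec c (tick s) s'" "I s'" "\<mu> s' < \<mu> s"
        using body[OF less.prems] by (auto simp: wp_def)
      have "frame c s0 s'"
        using frame_trans[OF less.prems(2)] exec_frame[OF s'(1)] by simp
      then have "wp (Loop a b c) P s'"
        using less.hyps s' by blast
      then show ?thesis
        unfolding wp_def using LoopT[of a s b c s'] sf True s'(1) by blast
    next
      case False
      then show ?thesis
        unfolding wp_def using LoopF[of a s b c] sf exit[OF less.prems] by blast
    qed
  qed
  then show ?thesis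
    using assms(1) by simp
qed

lemma set_reg_simps:
  "regs (set_reg r x f) = (regs f)(r := x)" "mem (set_reg r x f) = mem f"
  by (simp_all add: set_reg_def)

lemma program_answers:
  assumes "wp c (\<lambda>s. vr s Ans = (if b then 1 else 0) \<and> tm s \<le> n) blank"
    and inp: "\<And>i. inp i = (if i < length xs then xs ! i else 0)"
    and Q: "Q = inp 0 + 2 * inp 1 + inp 2 + inp 3 + 8" and "length xs \<le> Q"
  shows "answers_within W (program c) xs b (length prelude + length (program c) * n)"
proof -
  let ?f = "run W prelude (initial xs)"
  let ?P = "program c"
  have "?P = [] @ prelude @ compile (length prelude) c"
    by (simp add: program_def)
  moreover have pl: "list_all plain prelude"
    by (simp add: prelude_def)
  ultimately have pre: "(step W ?P ^^ length prelude) (initial xs) = ?f"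
    using plain_steps[of prelude "initial xs" "[]" W "compile (length prelude) c"]
    by (simp add: initial_def)
  have ip: "mem (initial xs) = inp"
    using inp by (auto simp: initial_def)
  have r0: "regs (initial xs) k = 0" for k
    by (simp add: initial_def)
  have m: "mem ?f = inp"
    by (simp add: prelude_def set_reg_simps ip)
  have odd: "reg x \<noteq> 1" "reg x \<noteq> 3" for x
    using even_reg[of x] by (auto simp del: even_reg)
  have r: "regs ?f (reg x) = 0" for x
    using odd[of x] by (simp add: prelude_def set_reg_simps r0)
  have "1 < (2::nat) ^ W" "8 < (2::nat) ^ W" "2 < (2::nat) ^ W" "3 < (2::nat) ^ W"
    using fits Q8 by linarith+
  then have "(1::nat) mod 2 ^ W = 1" "8 mod (2::nat) ^ W = 8" "2 mod (2::nat) ^ W = 2"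
      "3 mod (2::nat) ^ W = 3"
    by (simp_all only: mod_less)
  then have "regs ?f 1 = (inp 0 + inp 1 + inp 1 + inp 2 + inp 3 + 8) mod 2 ^ W"
    by (simp add: prelude_def set_reg_simps ip r0 mod_add_left_eq)
  also have "inp 0 + inp 1 + inp 1 + inp 2 + inp 3 + 8 = Q"
    using Q by simp
  finally have q: "regs ?f 1 = Q"
    using Q fits by simp
  have "represents ?f blank"
    unfolding represents_def
  proof (intro conjI allI impI)
    fix k i j
    \<comment> \<open>Array addresses start at \<open>Q\<close>, which is not before the end of the
      input, and there the memory is initially 0. Zeroed arrays thus cost no time.\<close>
    show "mem ?f (addr k i j) = ar blank k i j"
      using addr_ge[of k i j] assms(4) by (simp add: m inp blank_def)
  qed (use r q m in \<open>auto simp: blank_def\<close>)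
  moreover have "pc ?f = length prelude"
    using pc_run[OF pl, of W "initial xs"] by (simp add: initial_def)
  moreover obtain s' where s': "exec c blank s'" "vr s' Ans = (if b then 1 else 0)" "tm s' \<le> n"
    using assms(1) by (auto simp: wp_def)
  moreover have "simulates ?P (length prelude) (length ?P) blank s'"
    using compile_correct[OF s'(1), of ?P prelude "[]"] by (simp add: program_def)
  ultimately obtain t where t: "represents ((step W ?P ^^ t) ?f) s'"
      "pc ((step W ?P ^^ t) ?f) = length ?P" "t \<le> length ?P * tm s'"
    unfolding simulates_def by (force simp: blank_def)
  have "(step W ?P ^^ (t + length prelude)) (initial xs) = (step W ?P ^^ t) ?f"
    by (simp only: funpow_add o_apply pre)
  moreover have "regs ((step W ?P ^^ t) ?f) (reg Ans) = (if b then 1 else 0)"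
    using t(1) s'(2) by (simp only: represents_def)
  moreover have "t + length prelude \<le> length prelude + length ?P * n"
    using t(3) mult_le_mono2[OF s'(3), of "length ?P"] by linarith
  ultimately show ?thesis
    unfolding answers_within_def halted_def using t(2)
    by (intro exI[of _ "t + length prelude"]) simp
qed

end

section \<open>The failure tree and the matching automaton\<close>

definition sfx :: "'a list \<Rightarrow> nat \<Rightarrow> nat \<Rightarrow> bool" where
  "sfx T k i \<longleftrightarrow> suffix (take k T) (take i T)"

text \<open>The transition function of the Knuth-Morris-Pratt automaton. The maximum is over a
  finite set containing 0, and a transition exists even from the full string.\<close>

definition delta :: "'a list \<Rightarrow> nat \<Rightarrow> 'a \<Rightarrow> nat" where
  "delta T i a = Max {k. k \<le> length T \<and> suffix (take k T) (take i T @ [a])}"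

lemma sfx_refl [simp]: "sfx T k k"
  by (simp add: sfx_def)

lemma sfx_0 [simp]: "sfx T 0 i"
  by (simp add: sfx_def)

lemma sfx_trans: "sfx T i j \<Longrightarrow> sfx T j k \<Longrightarrow> sfx T i k"
  unfolding sfx_def by (rule suffix_order.trans)

text \<open>Suffixes of one string are linearly ordered by length. This is why the ancestors of a
  state form a chain, i.e. why the suffix order is a tree order.\<close>

lemma suffix_comparable:
  assumes "suffix (take k T) x" "suffix (take l T) x" "k \<le> l"
  shows "sfx T k l"
proof -
  have "length (take k T) \<le> length (take l T)"
    using assms(3) by simp
  then show ?thesis
    unfolding sfx_def using assms(1,2) by (rule suffix_length_suffix[rotated 2])
qed

lemma sfx_comparable: "sfx T k i \<Longrightarrow> sfx T l i \<Longrightarrow> k \<le> l \<Longrightarrow> sfx T k l"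
  using suffix_comparable by (auto simp: sfx_def)

lemma sfx_le:
  assumes "sfx T k i" "k \<le> length T"
  shows "k \<le> i"
proof -
  have "length (take k T) \<le> length (take i T)"
    using assms(1) unfolding sfx_def by (rule suffix_length_le)
  then show ?thesis
    using assms(2) by simp
qed

lemma delta_le: "delta T i a \<le> length T"
  and delta_suffix: "suffix (take (delta T i a) T) (take i T @ [a])"
proof -
  let ?K = "{k. k \<le> length T \<and> suffix (take k T) (take i T @ [a])}"
  have "Max ?K \<in> ?K"
    by (rule Max_in) (auto intro: exI[of _ 0])
  then show "delta T i a \<le> length T" "suffix (take (delta T i a) T) (take i T @ [a])"
    by (auto simp: delta_def)
qed

lemma delta_ge:
  assumes "k \<le> length T" "suffix (take k T) (take i T @ [a])"
  shows "k \<le> delta T i a"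
  unfolding delta_def using assms by (intro Max_ge) auto

text \<open>The longest candidate is greatest in the suffix order as well, not only numerically:
  every other extension is an ancestor of it. This monotonicity allows only the deepest state of a
  chain to be propagated.\<close>

lemma delta_sfx:
  assumes "k \<le> length T" "suffix (take k T) (take i T @ [a])"
  shows "sfx T k (delta T i a)"
  using suffix_comparable[OF assms(2) delta_suffix] delta_ge[OF assms] by blast

lemma suffix_take_Suc:
  assumes "k < length T"
  shows "suffix (take (Suc k) T) (x @ [a]) \<longleftrightarrow> T ! k = a \<and> suffix (take k T) x"
  using assms by (simp add: take_Suc_conv_app_nth)

lemma delta_next: "i < length T \<Longrightarrow> delta T i (T ! i) = Suc i"
proof (rule antisym)
  assume "i < length T"
  then show "Suc i \<le> delta T i (T ! i)"
    by (intro delta_ge) (simp_all add: suffix_take_Suc del: suffix_snoc)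
  have "length (take (delta T i (T ! i)) T) \<le> length (take i T @ [T ! i])"
    using delta_suffix by (rule suffix_length_le)
  then show "delta T i (T ! i) \<le> Suc i"
    using delta_le[of T i "T ! i"] by simp
qed

lemma delta_zero:
  assumes "T \<noteq> []"
  shows "delta T 0 a = (if T ! 0 = a then 1 else 0)"
proof (cases "T ! 0 = a")
  case True
  then show ?thesis
    using delta_next[of 0 T] assms by simp
next
  case False
  have "suffix (take (delta T 0 a) T) [a]"
    using delta_suffix[of T 0 a] by simp
  moreover have "delta T 0 a \<le> 1"
    using suffix_length_le[OF calculation] delta_le[of T 0 a] by simp
  ultimately show ?thesis
    using False assms suffix_take_Suc[of 0 T "[]" a] by (cases "delta T 0 a") auto
qed

section \<open>Borders and the failure function in terms of the suffix order\<close>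

lemma border_take_iff:
  assumes "i \<le> length T"
  shows "border b (take i T) \<longleftrightarrow> (\<exists>k < i. b = take k T \<and> sfx T k i)"
proof
  assume b: "border b (take i T)"
  then have "strict_prefix b (take i T)" "suffix b (take i T)"
    by (auto simp: border_def strict_suffix_def)
  moreover from this have "length b < i"
    using prefix_length_less[of b "take i T"] by simp
  moreover have "b = take (length b) T"
  proof -
    have "prefix b T"
      using calculation(1) take_is_prefix prefix_order.trans strict_prefix_def by blast
    then show ?thesis
      by (auto simp: prefix_def)
  qed
  ultimately show "\<exists>k < i. b = take k T \<and> sfx T k i"
    unfolding sfx_def by metis
next
  assume "\<exists>k < i. b = take k T \<and> sfx T k i"
  then obtain k where k: "k < i" "b = take k T" "suffix b (take i T)"
    by (auto simp: sfx_def)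
  have "length b \<noteq> length (take i T)"
    using k assms by simp
  then have "b \<noteq> take i T"
    by blast
  moreover have "prefix b (take i T)"
    using k take_is_prefix[of k "take i T"] by (simp add: min_def)
  ultimately show "border b (take i T)"
    using k by (simp add: border_def strict_suffix_def strict_prefix_def)
qed

lemma failure_eq:
  assumes "i \<le> length T"
  shows "failure T i = Max {k. k < i \<and> sfx T k i}"
proof -
  have "length (take k T) = k" if "k < i" for k
    using that assms by simp
  then have "(\<exists>b. k = length b \<and> border b (take i T)) \<longleftrightarrow> k < i \<and> sfx T k i" for k
    unfolding border_take_iff[OF assms] by metis
  then show ?thesis
    unfolding failure_def by presburger
qed

lemma
  assumes "1 \<le> i" "i \<le> length T"
  shows failure_less: "failure T i < i" and failure_sfx: "sfx T (failure T i) i"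
proof -
  have "Max {k. k < i \<and> sfx T k i} \<in> {k. k < i \<and> sfx T k i}"
    using assms by (intro Max_in) (auto intro!: exI[of _ 0])
  then show "failure T i < i" "sfx T (failure T i) i"
    using failure_eq[OF assms(2)] by auto
qed

lemma failure_ge:
  assumes "i \<le> length T" "k < i" "sfx T k i"
  shows "k \<le> failure T i"
  unfolding failure_eq[OF assms(1)] using assms by (intro Max_ge) auto

text \<open>A candidate \<open>k = Suc l\<close> asks that \<open>T ! l = a\<close> and that
  \<open>l\<close> be an ancestor. Requiring \<open>k <= i\<close> makes \<open>l\<close> a proper
  ancestor of \<open>i\<close>, and these are exactly the ancestors of
  \<open>failure T i\<close>.\<close>

lemma suffix_failure_snoc_iff:
  assumes "1 \<le> i" "i \<le> length T"
  shows "k \<le> length T \<and> suffix (take k T) (take (failure T i) T @ [a]) \<longleftrightarrow>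
    k \<le> length T \<and> k \<le> i \<and> suffix (take k T) (take i T @ [a])"
proof (cases k)
  case (Suc l)
  show ?thesis
  proof (cases "l < length T")
    case True
    have "sfx T l (failure T i) \<longleftrightarrow> l < i \<and> sfx T l i"
    proof
      assume l: "sfx T l (failure T i)"
      then show "l < i \<and> sfx T l i"
        using sfx_trans[OF l failure_sfx[OF assms]] sfx_le[OF l] failure_less[OF assms] True by auto
    next
      assume "l < i \<and> sfx T l i"
      then show "sfx T l (failure T i)"
        using failure_ge[OF assms(2)] failure_sfx[OF assms] sfx_comparable by blast
    qed
    then show ?thesis
      using True by (auto simp: Suc suffix_take_Suc sfx_def simp del: suffix_snoc)
  qed (use Suc in auto)
qed simp

text \<open>If the next symbol is not \<open>a\<close>, the candidate \<open>Suc i\<close> drops out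
  and only those of the failure state remain. Hence row \<open>i\<close> of the table is a copy of
  an earlier row except in one entry.\<close>

lemma delta_failure:
  assumes "1 \<le> i" "i \<le> length T" "i < length T \<Longrightarrow> T ! i \<noteq> a"
  shows "delta T i a = delta T (failure T i) a"
proof -
  have "k \<le> i" if "k \<le> length T" "suffix (take k T) (take i T @ [a])" for k
  proof -
    have "length (take k T) \<le> length (take i T @ [a])"
      using that(2) by (rule suffix_length_le)
    moreover have "k \<noteq> Suc i"
      using that assms(3) suffix_take_Suc[of i T "take i T" a] by auto
    ultimately show ?thesis
      using that(1) assms(2) by simp
  qed
  then have "k \<le> length T \<and> suffix (take k T) (take i T @ [a]) \<longleftrightarrow>
      k \<le> length T \<and> suffix (take k T) (take (failure T i) T @ [a])" for k
    unfolding suffix_failure_snoc_iff[OF assms(1,2)] by blast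
  then show ?thesis
    unfolding delta_def by simp
qed

text \<open>Borders of the longer prefix extend borders of the shorter one by a letter. The failure
  function is therefore obtained by a single lookup per state while the table grows.\<close>

lemma failure_Suc:
  assumes "1 \<le> i" "i < length T"
  shows "failure T (Suc i) = delta T (failure T i) (T ! i)"
proof -
  have "k < Suc i \<and> sfx T k (Suc i) \<longleftrightarrow>
      k \<le> length T \<and> suffix (take k T) (take (failure T i) T @ [T ! i])" for k
    using assms suffix_failure_snoc_iff[of i T k "T ! i"]
    by (auto simp: sfx_def take_Suc_conv_app_nth)
  moreover have "failure T (Suc i) = Max {k. k < Suc i \<and> sfx T k (Suc i)}"
    using assms by (intro failure_eq) auto
  ultimately show ?thesis
    unfolding delta_def by simp
qed

lemma failure_1: "T \<noteq> [] \<Longrightarrow> failure T 1 = 0"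
  using failure_less[of 1 T] by (cases T) auto

section \<open>Leaves of the failure tree and its decomposition into chains\<close>

definition leaf :: "'a list \<Rightarrow> nat \<Rightarrow> bool" where
  "leaf T i \<longleftrightarrow> \<not> (\<exists>j \<in> {1..length T}. failure T j = i)"

lemma failure_width_leaf: "failure_width T = card {i \<in> {0..length T}. leaf T i}"
  by (simp add: failure_width_def leaf_def)

text \<open>The full length is always a leaf, since failure values are smaller than their argument.
  Positivity later absorbs terms linear in the graph size.\<close>

lemma failure_width_pos: "0 < failure_width T"
proof -
  have "leaf T (length T)"
    unfolding leaf_def using failure_less[of _ T] by force
  then have "{i \<in> {0..length T}. leaf T i} \<noteq> {}"
    by auto
  then show ?thesis
    unfolding failure_width_leaf by (simp add: card_gt_0_iff)
qed

lemma failure_width_le: "failure_width T \<le> Suc (length T)"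
proof -
  have "failure_width T \<le> card {0..length T}"
    unfolding failure_width_def by (intro card_mono) auto
  then show ?thesis by simp
qed

text \<open>\<open>sfx T\<close> is the ancestor relation of the failure tree; colour \<open>0\<close> means uncoloured.\<close>

definition chain_colours :: "'a list \<Rightarrow> (nat \<Rightarrow> nat) \<Rightarrow> bool" where
  "chain_colours T ch \<longleftrightarrow> (\<forall>k l. k \<le> l \<longrightarrow> l \<le> length T \<longrightarrow> ch k = ch l \<longrightarrow> ch k \<noteq> 0 \<longrightarrow> sfx T k l)"

text \<open>The state of the colouring after the states \<open>\<ge> i\<close> have been treated: a state below \<open>i\<close>
  has a colour iff it has inherited one from a child.\<close>

definition colouring :: "'a list \<Rightarrow> nat \<Rightarrow> (nat \<Rightarrow> nat) \<Rightarrow> nat \<Rightarrow> bool" where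
  "colouring T i ch w \<longleftrightarrow> chain_colours T ch
     \<and> w = card {l \<in> {i..length T}. leaf T l}
     \<and> (\<forall>k \<le> length T. ch k \<le> w)
     \<and> (\<forall>k \<in> {i..length T}. 0 < ch k)
     \<and> (\<forall>k < i. 0 < ch k \<longleftrightarrow> (\<exists>j \<in> {i..length T}. failure T j = k))"

lemma colouring_init: "colouring T (Suc (length T)) (\<lambda>_. 0) 0"
  by (auto simp: colouring_def chain_colours_def)

text \<open>A state \<open>l\<close> coloured like \<open>i\<close> is comparable with
  \<open>i\<close>. Below \<open>i\<close> in the tree it is a descendant of the ancestor
  \<open>p\<close> too; above \<open>i\<close>, both \<open>l\<close> and \<open>p\<close> are
  ancestors of \<open>i\<close> and so comparable. A previous colour of \<open>p\<close> is simply
  overwritten, which only shrinks another chain.\<close>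

lemma chain_colours_inherit:
  assumes "chain_colours T ch" "i \<le> length T" "sfx T p i" "p \<le> i" "ch i \<noteq> 0"
  shows "chain_colours T (ch(p := ch i))"
  unfolding chain_colours_def
proof (intro allI impI)
  fix k l assume kl: "k \<le> l" "l \<le> length T" "(ch(p := ch i)) k = (ch(p := ch i)) l"
    "(ch(p := ch i)) k \<noteq> 0"
  have *: "sfx T p l \<or> sfx T l i" if "ch l = ch i" "l \<le> length T" for l
  proof (cases "l \<le> i")
    case True
    then show ?thesis
      using assms(1,2,5) that by (auto simp: chain_colours_def)
  next
    case False
    then have "sfx T i l"
      using assms(1,5) that unfolding chain_colours_def by (metis nat_le_linear)
    then show ?thesis
      using assms(3) sfx_trans by blast
  qed
  consider "k = p" "l = p" | "k = p" "l \<noteq> p" | "k \<noteq> p" "l = p" | "k \<noteq> p" "l \<noteq> p"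
    by blast
  then show "sfx T k l"
  proof cases
    case 2
    then show ?thesis
      using *[of l] kl assms(3) sfx_comparable by auto
  next
    case 3
    then have "sfx T k i"
      using assms(1,2,4,5) kl by (auto simp: chain_colours_def)
    then show ?thesis
      using 3 kl(1) assms(3) sfx_comparable by blast
  qed (use assms(1) kl in \<open>auto simp: chain_colours_def\<close>)
qed

text \<open>When \<open>i\<close> has its turn, all its children have been treated, so it is
  uncoloured exactly if it is a leaf. New colours are thus opened only at leaves, and their number
  becomes the width. State 0 is taken as its own parent, making the last inheritance void.\<close>

lemma colouring_step:
  assumes c: "colouring T (Suc i) ch w" and i: "i \<le> length T"
    and w': "w' = (if 0 < ch i then w else Suc w)"
    and ch': "ch' = (if 0 < ch i then ch else ch(i := w'))"
    and p: "p = (if i = 0 then 0 else failure T i)"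
  shows "colouring T i (ch'(p := ch' i)) w'"
proof -
  have C: "chain_colours T ch" "w = card {l \<in> {Suc i..length T}. leaf T l}"
    "\<And>k. k \<le> length T \<Longrightarrow> ch k \<le> w" "\<And>k. k \<in> {Suc i..length T} \<Longrightarrow> 0 < ch k"
    "\<And>k. k < Suc i \<Longrightarrow> 0 < ch k \<longleftrightarrow> (\<exists>j \<in> {Suc i..length T}. failure T j = k)"
    using c unfolding colouring_def by blast+
  have child: "(\<exists>j \<in> {Suc i..length T}. failure T j = i) \<longleftrightarrow> \<not> leaf T i"
    unfolding leaf_def using failure_less[of _ T] by fastforce
  have 1: "chain_colours T ch'"
  proof (cases "0 < ch i")
    case False
    \<comment> \<open>The new colour is fresh, so it starts a chain with a single state.\<close>
    have "ch k \<noteq> Suc w" if "k \<le> length T" for k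
      using C(3)[OF that] by simp
    then show ?thesis
      using C(1) False unfolding ch' w' chain_colours_def
      by (auto split: if_splits) (metis le_trans)+
  qed (use C ch' in simp)
  have 2: "w' = card {l \<in> {i..length T}. leaf T l}"
  proof -
    have "{i..length T} = insert i {Suc i..length T}"
      using i by auto
    then have "{l \<in> {i..length T}. leaf T l}
        = (if leaf T i then insert i {l \<in> {Suc i..length T}. leaf T l}
           else {l \<in> {Suc i..length T}. leaf T l})"
      by auto
    then show ?thesis
      using C(2) C(5)[of i] child by (auto simp: w')
  qed
  have 3: "ch' k \<le> w'" if "k \<le> length T" for k
    using C(3)[OF that] by (auto simp: ch' w')
  have 4: "0 < ch' k" if "k \<in> {i..length T}" for k
  proof (cases "k = i")
    case False
    then show ?thesis
      using C(4)[of k] that by (auto simp: ch')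
  qed (auto simp: ch' w')
  have 5: "0 < ch' k \<longleftrightarrow> (\<exists>j \<in> {Suc i..length T}. failure T j = k)" if "k < i" for k
    using C(5)[of k] that by (auto simp: ch')
  have p': "sfx T p i" "p \<le> i" "p < i \<or> i = 0"
    using failure_sfx[of i T] failure_less[of i T] i by (auto simp: p)
  have "{i..length T} = insert i {Suc i..length T}"
    using i by auto
  then have 6: "0 < (ch'(p := ch' i)) k \<longleftrightarrow> (\<exists>j \<in> {i..length T}. failure T j = k)" if "k < i" for k
    using 5[OF that] 4[of i] that i by (auto simp: p)
  have "chain_colours T (ch'(p := ch' i))"
    using 1 i p' 4[of i] by (intro chain_colours_inherit) auto
  then show ?thesis
    unfolding colouring_def using 2 3 4 6 i p' by auto
qed

section \<open>Propagating states along the edges\<close>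

lemma successively_trancl:
  "successively (\<lambda>u v. (u, v) \<in> R) (x # p) \<Longrightarrow> y \<in> set p \<Longrightarrow> (x, y) \<in> R\<^sup>+"
proof (induction p arbitrary: x)
  case (Cons z p)
  then have z: "(x, z) \<in> R" "successively (\<lambda>u v. (u, v) \<in> R) (z # p)"
    by auto
  show ?case
  proof (cases "y = z")
    case False
    then have "(z, y) \<in> R\<^sup>+"
      using Cons.IH[OF z(2)] Cons.prems(2) by simp
    with z(1) show ?thesis
      by (rule trancl_into_trancl2)
  qed (use z in blast)
qed simp

text \<open>A repeated vertex would close a cycle. Distinctness thus needs no bookkeeping when walks
  are extended by an edge.\<close>

lemma acyclic_successively_distinct:
  "acyclic R \<Longrightarrow> successively (\<lambda>u v. (u, v) \<in> R) p \<Longrightarrow> distinct p"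
proof (induction p)
  case (Cons x p)
  then have "x \<notin> set p"
    using successively_trancl[of R x p x] by (auto simp: acyclic_def)
  moreover have "distinct p"
    using Cons by (cases p) auto
  ultimately show ?case by simp
qed simp

text \<open>One plus the index of the last of the first \<open>x\<close> edges leaving \<open>u\<close>, or \<open>0\<close>.\<close>

fun prev :: "(nat \<Rightarrow> nat) \<Rightarrow> nat \<Rightarrow> nat \<Rightarrow> nat" where
  "prev src 0 u = 0"
| "prev src (Suc x) u = (if src x = u then Suc x else prev src x u)"

lemma prev_le: "prev src x u \<le> x"
  by (induction x) auto

lemma prev_src: "prev src x u = Suc j \<Longrightarrow> src j = u"
  by (induction x) (auto split: if_splits)

text \<open>Following \<open>prev\<close> from the end skips only edges with another source, so the
  linked list of \<open>u\<close> contains every edge leaving \<open>u\<close>.\<close>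

lemma prev_gap: "prev src x u \<le> j \<Longrightarrow> j < x \<Longrightarrow> src j \<noteq> u"
  by (induction x) (auto split: if_splits elim: less_SucE)

section \<open>Walks and the states reached along them\<close>

locale labelled_dag =
  fixes n e :: nat and src dst lb :: "nat \<Rightarrow> nat" and T :: "nat list"
  assumes src_less: "j < e \<Longrightarrow> src j < n" and dst_less: "j < e \<Longrightarrow> dst j < n"
    and acyclic_edges: "acyclic ((\<lambda>j. (src j, dst j)) ` {..<e})"
    and T_nonempty: "T \<noteq> []"
begin

abbreviation "m \<equiv> length T"

definition edges :: "(nat \<times> nat) set" where
  "edges = (\<lambda>j. (src j, dst j)) ` {..<e}"

definition walk :: "nat list \<Rightarrow> bool" where
  "walk p \<longleftrightarrow> set p \<subseteq> {..<n} \<and> successively (\<lambda>u v. (u, v) \<in> edges) p"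

text \<open>The walk is nonempty, so state 0 is never reached in this sense; 0 remains free as the
  value of an empty slot.\<close>

definition reach :: "nat \<Rightarrow> nat \<Rightarrow> bool" where
  "reach v i \<longleftrightarrow> (\<exists>p. walk p \<and> p \<noteq> [] \<and> last p = v \<and> map lb p = take i T)"

lemma path_iff_walk: "path {..<n} edges p \<longleftrightarrow> walk p"
  using acyclic_successively_distinct[of edges p] acyclic_edges
  by (auto simp: path_def walk_def edges_def)

lemma has_match_iff_reach: "has_match {..<n} edges lb T \<longleftrightarrow> (\<exists>v < n. reach v m)"
proof
  assume "has_match {..<n} edges lb T"
  then obtain p where p: "walk p" "map lb p = T"
    by (auto simp: has_match_def path_iff_walk)
  then have "p \<noteq> []"
    using T_nonempty by auto
  moreover from this have "last p \<in> {..<n}"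
    using p(1) last_in_set[of p] unfolding walk_def by blast
  ultimately show "\<exists>v < n. reach v m"
    using p by (auto simp: reach_def)
qed (auto simp: has_match_def path_iff_walk reach_def)

text \<open>Soundness of a transition: append \<open>v\<close> to a walk reaching \<open>i\<close>
  (the empty one for \<open>i = 0\<close>) and cut off its beginning, as a suffix of a walk is a
  walk.\<close>

lemma reach_step:
  assumes "v < n" "i = 0 \<or> (\<exists>j < e. dst j = v \<and> reach (src j) i)"
    "k \<noteq> 0" "suffix (take k T) (take i T @ [lb v])"
  shows "reach v k"
proof -
  obtain p where p: "walk (p @ [v])" "map lb p = take i T"
  proof (cases "i = 0")
    case True
    then show ?thesis
      using that[of "[]"] assms(1) by (simp add: walk_def)
  next
    case False
    then obtain j where j: "j < e" "dst j = v" "reach (src j) i"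
      using assms(2) by auto
    then obtain p where p: "walk p" "p \<noteq> []" "last p = src j" "map lb p = take i T"
      by (auto simp: reach_def)
    moreover have "(src j, v) \<in> edges"
      using j by (auto simp: edges_def)
    ultimately show ?thesis
      using that[of p] assms(1) by (auto simp: walk_def successively_append_iff)
  qed
  \<comment> \<open>\<open>z\<close> is the part of the label that the transition forgets; as many
    vertices are dropped from the walk.\<close>
  obtain z where "take i T @ [lb v] = z @ take k T"
    using assms(4) by (auto simp: suffix_def simp del: suffix_snoc)
  then have "map lb (p @ [v]) = z @ take k T"
    using p(2) by simp
  then have q: "map lb (drop (length z) (p @ [v])) = take k T"
    by (metis append_eq_conv_conj drop_map)
  let ?q = "drop (length z) (p @ [v])"
  have ne: "?q \<noteq> []"
    using q assms(3) T_nonempty by (metis map_is_Nil_conv take_eq_Nil)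
  have "walk (take (length z) (p @ [v]) @ ?q)"
    using p(1) by (simp only: append_take_drop_id)
  then have "walk ?q"
    unfolding walk_def successively_append_iff by (auto dest: in_set_dropD)
  moreover have "last ?q = v"
    using ne by (metis drop_eq_Nil last_drop last_snoc not_le)
  ultimately show ?thesis
    using q ne unfolding reach_def by blast
qed

end

section \<open>Rows holding one state per chain\<close>

locale coloured_dag = labelled_dag +
  fixes ch :: "nat \<Rightarrow> nat" and w :: nat
  assumes chain_colours: "chain_colours T ch"
    and ch_pos: "k \<le> length T \<Longrightarrow> 0 < ch k" and ch_le: "k \<le> length T \<Longrightarrow> ch k \<le> w"
begin

definition row :: "nat \<Rightarrow> (nat \<Rightarrow> nat) \<Rightarrow> bool" where
  "row v y \<longleftrightarrow> (\<forall>c. y c \<le> m \<and> (y c \<noteq> 0 \<longrightarrow> ch (y c) = c \<and> reach v (y c)))"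

definition extends :: "(nat \<Rightarrow> nat) \<Rightarrow> (nat \<Rightarrow> nat) \<Rightarrow> bool" where
  "extends y z \<longleftrightarrow> (\<forall>c. sfx T (y c) (z c))"

text \<open>Completeness is stated up to ancestors: the row need not contain \<open>i\<close>, only
  a state of which \<open>i\<close> is an ancestor.\<close>

definition covers :: "(nat \<Rightarrow> nat) \<Rightarrow> nat \<Rightarrow> bool" where
  "covers y i \<longleftrightarrow> (\<exists>c \<in> {1..w}. sfx T i (y c))"

definition merge :: "(nat \<Rightarrow> nat) \<Rightarrow> nat \<Rightarrow> nat \<Rightarrow> nat" where
  "merge y j = (if y (ch j) < j then y(ch j := j) else y)"

lemma extends_refl: "extends y y"
  by (simp add: extends_def)

lemma extends_trans: "extends x y \<Longrightarrow> extends y z \<Longrightarrow> extends x z"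
  unfolding extends_def using sfx_trans by blast

lemma covers_extends: "covers y i \<Longrightarrow> extends y z \<Longrightarrow> covers z i"
  unfolding covers_def extends_def using sfx_trans by blast

lemma covers_sfx: "covers y i \<Longrightarrow> sfx T k i \<Longrightarrow> covers y k"
  unfolding covers_def using sfx_trans by blast

lemma row_zero: "row v (\<lambda>_. 0)"
  by (simp add: row_def)

text \<open>The entry in slot \<open>ch j\<close> has the colour of \<open>j\<close> unless it is 0,
  so it is comparable with \<open>j\<close> in the suffix order. Hence the numerically larger of the
  two has the other one as an ancestor, and nothing covered is lost.\<close>

lemma
  assumes "row v y" "j \<le> m" "j \<noteq> 0 \<Longrightarrow> reach v j"
  shows row_merge: "row v (merge y j)" and extends_merge: "extends y (merge y j)"
    and covers_merge: "covers (merge y j) j"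
proof -
  have y: "y c \<le> m" "y c \<noteq> 0 \<Longrightarrow> ch (y c) = c" for c
    using assms(1) by (auto simp: row_def)
  show "row v (merge y j)"
    using assms by (auto simp: row_def merge_def)
  have "sfx T (y (ch j)) j" if "y (ch j) < j"
  proof (cases "y (ch j) = 0")
    case False
    then have "ch (y (ch j)) = ch j"
      using y(2) by blast
    then show ?thesis
      using chain_colours that assms(2) ch_pos[of j] unfolding chain_colours_def
      by (metis less_imp_le less_numeral_extra(3))
  qed simp
  then show "extends y (merge y j)"
    by (auto simp: extends_def merge_def)
  have "sfx T j (y (ch j))" if "\<not> y (ch j) < j"
  proof (cases "y (ch j) = 0")
    case True
    then show ?thesis
      using that by simp
  next
    case False
    then have "ch (y (ch j)) = ch j"
      using y(2) by blast
    then show ?thesis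
      using chain_colours that y(1)[of "ch j"] assms(2) ch_pos[of j] unfolding chain_colours_def
      by (metis less_numeral_extra(3) not_le)
  qed
  then have "sfx T j (merge y j (ch j))"
    by (auto simp: merge_def)
  then show "covers (merge y j) j"
    using ch_pos[OF assms(2)] ch_le[OF assms(2)] by (force simp: covers_def)
qed

text \<open>Induction on the prefix length. The predecessor on the walk stores some state of which
  \<open>i\<close> is an ancestor; by \<open>delta_sfx\<close> the transition from this state has
  \<open>Suc i\<close> as an ancestor.\<close>

lemma covers_reach:
  assumes init: "\<And>v. v < n \<Longrightarrow> covers (M v) (delta T 0 (lb v))"
    and edge: "\<And>j c. j < e \<Longrightarrow> c \<in> {1..w} \<Longrightarrow> covers (M (dst j)) (delta T (M (src j) c) (lb (dst j)))"
  shows "reach v i \<Longrightarrow> i \<le> m \<Longrightarrow> covers (M v) i"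
proof (induction i arbitrary: v)
  case 0
  then show ?case
    by (auto simp: reach_def)
next
  case (Suc i)
  then obtain p where p: "walk p" "p \<noteq> []" "last p = v" "map lb p = take (Suc i) T"
    by (auto simp: reach_def)
  obtain q where q: "p = q @ [v]"
    using p(2,3) append_butlast_last_id by metis
  have lq: "map lb q = take i T" "lb v = T ! i"
    using p(4) Suc.prems(2) by (auto simp: q take_Suc_conv_app_nth)
  have v: "v < n"
    using p(1) by (auto simp: q walk_def)
  have i: "i < length T"
    using Suc.prems by simp
  show ?case
  proof (cases "q = []")
    case True
    then have "i = 0"
      using lq(1) i by auto
    have "suffix (take (Suc i) T) (take i T @ [lb v])"
      by (simp only: suffix_take_Suc[OF i] lq suffix_order.refl)
    then have "sfx T (Suc i) (delta T i (lb v))"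
      using Suc.prems by (intro delta_sfx)
    then have "sfx T (Suc i) (delta T 0 (lb v))"
      unfolding \<open>i = 0\<close> .
    then show ?thesis
      using covers_sfx init[OF v] by blast
  next
    case False
    define u where "u = last q"
    have "(u, v) \<in> edges" "walk q"
      using p(1) False by (auto simp: q walk_def successively_append_iff u_def)
    then obtain j where j: "j < e" "src j = u" "dst j = v" "walk q"
      by (auto simp: edges_def)
    then have "reach u i"
      using False lq by (auto simp: reach_def u_def)
    then have "covers (M u) i"
      using Suc by simp
    then obtain c where c: "c \<in> {1..w}" "sfx T i (M u c)"
      by (auto simp: covers_def)
    have "suffix (take (Suc i) T) (take (M u c) T @ [lb v])"
      using c(2) lq(2) by (simp only: suffix_take_Suc[OF i] sfx_def)
    then have "sfx T (Suc i) (delta T (M u c) (lb v))"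
      using Suc.prems by (intro delta_sfx)
    then show ?thesis
      using covers_sfx edge[OF j(1) c(1)] j by blast
  qed
qed

text \<open>No state up to \<open>m\<close> other than \<open>m\<close> itself can cover
  \<open>m\<close>, so coverage turns into equality, and \<open>row\<close> identifies the
  slot.\<close>

lemma has_match_iff_marked:
  assumes rows: "\<And>v. v < n \<Longrightarrow> row v (M v)"
    and init: "\<And>v. v < n \<Longrightarrow> covers (M v) (delta T 0 (lb v))"
    and edge: "\<And>j c. j < e \<Longrightarrow> c \<in> {1..w} \<Longrightarrow> covers (M (dst j)) (delta T (M (src j) c) (lb (dst j)))"
  shows "has_match {..<n} edges lb T \<longleftrightarrow> (\<exists>v < n. M v (ch m) = m)"
proof -
  have "reach v m \<longleftrightarrow> M v (ch m) = m" if v: "v < n" for v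
  proof
    assume "reach v m"
    then have "covers (M v) m"
      using covers_reach[OF init edge] by simp
    then obtain c where "sfx T m (M v c)"
      by (auto simp: covers_def)
    then have "m \<le> M v c"
      using sfx_le by blast
    then have "M v c = m"
      using rows[OF v] by (simp add: row_def le_antisym)
    moreover have "M v c \<noteq> 0"
      using T_nonempty calculation by simp
    ultimately show "M v (ch m) = m"
      using rows[OF v] unfolding row_def by metis
  next
    assume "M v (ch m) = m"
    moreover have "m \<noteq> 0"
      using T_nonempty by simp
    ultimately show "reach v m"
      using rows[OF v] unfolding row_def by metis
  qed
  then show ?thesis
    unfolding has_match_iff_reach by blast
qed

text \<open>\<open>D\<close> is the set of edges already used, and \<open>q\<close>, filled up to \<open>b\<close>, holds the vertices all
  of whose incoming edges have been used. No edge of \<open>D\<close> leaves a vertex outside the queue,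
  so the rows from which \<open>D\<close> was propagated no longer change.\<close>

definition kahn :: "nat set \<Rightarrow> (nat \<Rightarrow> nat \<Rightarrow> nat) \<Rightarrow> (nat \<Rightarrow> nat) \<Rightarrow> (nat \<Rightarrow> nat) \<Rightarrow> nat \<Rightarrow> bool" where
  "kahn D M deg q b \<longleftrightarrow> D \<subseteq> {..<e}
     \<and> (\<forall>v < n. deg v = card {j \<in> {..<e} - D. dst j = v})
     \<and> inj_on q {..<b} \<and> q ` {..<b} = {v. v < n \<and> deg v = 0}
     \<and> (\<forall>v < n. row v (M v)) \<and> (\<forall>v < n. covers (M v) (delta T 0 (lb v)))
     \<and> (\<forall>j \<in> D. \<forall>c \<in> {1..w}. covers (M (dst j)) (delta T (M (src j) c) (lb (dst j))))
     \<and> (\<forall>j \<in> D. src j \<in> q ` {..<b})"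

lemma kahn_step:
  assumes k: "kahn D M deg q b" and j: "j < e" "j \<notin> D" "src j \<in> q ` {..<b}"
    and v: "v = dst j"
    and y: "row v y" "extends (M v) y"
      "\<And>c. c \<in> {1..w} \<Longrightarrow> covers y (delta T (M (src j) c) (lb v))"
    and deg': "deg' = deg(v := deg v - 1)"
    and q': "q' = (if deg' v = 0 then q(b := v) else q)"
    and b': "b' = (if deg' v = 0 then Suc b else b)"
  shows "kahn (insert j D) (M(v := y)) deg' q' b'"
proof -
  have "D \<subseteq> {..<e}" "\<forall>v < n. deg v = card {j \<in> {..<e} - D. dst j = v}"
    "inj_on q {..<b}" "q ` {..<b} = {v. v < n \<and> deg v = 0}"
    "\<forall>v < n. row v (M v)" "\<forall>v < n. covers (M v) (delta T 0 (lb v))"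
    "\<forall>j \<in> D. \<forall>c \<in> {1..w}. covers (M (dst j)) (delta T (M (src j) c) (lb (dst j)))"
    "\<forall>j \<in> D. src j \<in> q ` {..<b}"
    using k unfolding kahn_def by - (elim conjE, assumption)+
  note K = this(1) this(2)[rule_format] this(3,4) this(5-8)[rule_format]
  have vn: "v < n"
    using j v dst_less by simp
  let ?R = "\<lambda>D u. {j \<in> {..<e} - D. dst j = u}"
  have R: "?R (insert j D) u = ?R D u" if "u \<noteq> v" for u
    using v that by auto
  have Rv: "?R D v = insert j (?R (insert j D) v)"
    using j v by auto
  have deg_v: "deg v = Suc (card (?R (insert j D) v))"
    unfolding K(2)[OF vn] Rv by (subst card_insert_disjoint) auto
  have 1: "deg' u = card (?R (insert j D) u)" if "u < n" for u
    using R[of u] K(2)[OF that] deg_v by (auto simp: deg')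
  have vq: "v \<notin> q ` {..<b}"
    using K(4) deg_v by simp
  have im: "q' ` {..<b'} = (if deg' v = 0 then insert v (q ` {..<b}) else q ` {..<b})"
    by (auto simp: q' b' lessThan_Suc)
  have 2: "inj_on q' {..<b'}"
  proof (cases "deg' v = 0")
    case True
    have "inj_on (q(b := v)) {..<b}"
      using K(3) by (simp add: inj_on_def)
    then show ?thesis
      using vq True by (auto simp: q' b' lessThan_Suc)
  qed (use K(3) in \<open>simp add: q' b'\<close>)
  have 3: "q' ` {..<b'} = {u. u < n \<and> deg' u = 0}"
    unfolding im K(4) using vn deg_v by (auto simp: deg')
  have src: "src i \<noteq> v" "src i \<in> q ` {..<b}" if "i \<in> insert j D" for i
    using that vq j K(8)[of i] by auto
  have 4: "covers ((M(v := y)) (dst i)) (delta T ((M(v := y)) (src i) c) (lb (dst i)))"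
    if "i \<in> insert j D" "c \<in> {1..w}" for i c
  proof (cases "i \<in> D")
    case True
    then show ?thesis
      using src(1)[OF that(1)] K(7)[of i c] that y(2) covers_extends by auto
  next
    case False
    then show ?thesis
      using src(1)[OF that(1)] y(3) that v by auto
  qed
  have 5: "covers ((M(v := y)) u) (delta T 0 (lb u))" if "u < n" for u
    using K(6)[OF that] y(2) covers_extends by auto
  have 6: "row u ((M(v := y)) u)" if "u < n" for u
    using K(5)[OF that] y(1) by auto
  have 7: "src i \<in> q' ` {..<b'}" if "i \<in> insert j D" for i
    using src(2)[OF that] unfolding im by auto
  show ?thesis
    unfolding kahn_def
  proof (intro conjI allI impI ballI)
    show "insert j D \<subseteq> {..<e}"
      using K(1) j(1) by auto
  qed ((rule 2 3) | (rule 1 4 5 6 7; assumption))+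
qed

lemma kahn_target:
  assumes "kahn D M deg q b" "j < e" "j \<notin> D"
  shows "dst j \<notin> q ` {..<b}"
proof -
  have "j \<in> {i \<in> {..<e} - D. dst i = dst j}"
    using assms by simp
  then have "card {i \<in> {..<e} - D. dst i = dst j} \<noteq> 0"
    by (metis (no_types, lifting) card_eq_0_iff empty_iff finite_Diff finite_Collect_conjI finite_lessThan
        finite_subset mem_Collect_eq subsetI)
  then show ?thesis
    using assms(1) dst_less[OF assms(2)] by (simp add: kahn_def)
qed

text \<open>Well-founded induction along the edges: if all predecessors of \<open>v\<close> are
  queued, all edges into \<open>v\<close> have been used, its degree is 0 and \<open>v\<close> is
  queued. Acyclicity makes this a valid induction.\<close>

lemma kahn_complete:
  assumes "kahn D M deg q b" "\<And>j. j < e \<Longrightarrow> src j \<in> q ` {..<b} \<Longrightarrow> j \<in> D"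
  shows "D = {..<e}"
proof -
  have wf: "wf edges"
    using acyclic_edges by (intro finite_acyclic_wf) (auto simp: edges_def)
  have "v < n \<longrightarrow> v \<in> q ` {..<b}" for v
  proof (induction v rule: wf_induct_rule[OF wf])
    case (1 v)
    show ?case
    proof
      assume v: "v < n"
      have "{j \<in> {..<e} - D. dst j = v} = {}"
        using 1 assms(2) src_less by (auto simp: edges_def)
      then have "deg v = 0"
        using assms(1) v unfolding kahn_def by (metis card.empty)
      then show "v \<in> q ` {..<b}"
        using assms(1) v unfolding kahn_def by blast
    qed
  qed
  then have "j \<in> D" if "j < e" for j
    using assms(2)[OF that] src_less[OF that] by blast
  moreover have "D \<subseteq> {..<e}"
    using assms(1) by (simp add: kahn_def)
  ultimately show ?thesis
    by auto
qed

lemma kahn_le: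
  assumes "kahn D M deg q b"
  shows "b \<le> n"
proof -
  have "inj_on q {..<b}" "q ` {..<b} \<subseteq> {..<n}"
    using assms by (auto simp: kahn_def)
  then show ?thesis
    using card_inj_on_le[of q "{..<b}" "{..<n}"] by simp
qed

lemma kahn_has_match:
  assumes "kahn {..<e} M deg q b"
  shows "has_match {..<n} edges lb T \<longleftrightarrow> (\<exists>v < n. M v (ch m) = m)"
proof (rule has_match_iff_marked)
  show "row v (M v)" "covers (M v) (delta T 0 (lb v))" if "v < n" for v
    using assms that by (simp_all add: kahn_def)
  show "covers (M (dst j)) (delta T (M (src j) c) (lb (dst j)))" if "j < e" "c \<in> {1..w}" for j c
    using assms that by (simp add: kahn_def)
qed

end

section \<open>The algorithm\<close>

text \<open>\<open>Mark\<close> holds, for a vertex \<open>v\<close> and a chain \<open>c\<close>, the deepest state of \<open>c\<close> known to be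
  reached at \<open>v\<close>; all arrays start out as \<open>0\<close>. In \<open>Head\<close>, \<open>Next\<close> and \<open>Edge\<close> edges are
  numbered from \<open>1\<close>, and \<open>0\<close> terminates a list.\<close>

abbreviation "label_of x \<equiv> Inp (Pls (Lit 4) x)"
text \<open>The offsets mirror \<open>encode\<close>: four header words, then the labels, then two
  words per edge. Doubling is a sum, as expressions have no product.\<close>

abbreviation "source_of x \<equiv> Inp (Pls (Pls (Lit 4) (Var NumV)) (Pls x x))"
abbreviation "target_of x \<equiv> Inp (Pls (Pls (Lit 5) (Var NumV)) (Pls x x))"
abbreviation "symbol_at x \<equiv> Inp (Pls (Pls (Lit 4) (Var NumV)) (Pls (Pls (Var NumE) (Var NumE)) x))"
abbreviation "Get1 k x \<equiv> Get k x (Lit 0)"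
abbreviation "Put1 k x y \<equiv> Put k x (Lit 0) y"
abbreviation "incr x \<equiv> x ::= Pls (Var x) (Lit 1)"

text \<open>The edge list is not grouped by source, so adjacency lists are threaded through
  \<open>Next\<close>, newest edge first, while in-degrees are counted.\<close>

definition link_edge :: com where
  "link_edge =
     Src ::= source_of (Var Ix) ;;
     Dst ::= target_of (Var Ix) ;;
     Put1 Next (Pls (Var Ix) (Lit 1)) (Get1 Head (Var Src)) ;;
     Put1 Head (Var Src) (Pls (Var Ix) (Lit 1)) ;;
     Put1 Deg (Var Dst) (Pls (Get1 Deg (Var Dst)) (Lit 1)) ;;
     incr Ix"

definition link_edges :: com where
  "link_edges = Ix ::= Lit 0 ;; Loop (Var Ix) (Var NumE) link_edge"

definition copy_row :: com where
  "copy_row =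
     Sym ::= Lit 0 ;;
     Loop (Var Sym) (Var NumA)
      (Put Delta (Var Ix) (Var Sym) (Get Delta (Var Fl) (Var Sym)) ;; incr Sym)"

text \<open>The row of the failure state is copied and then corrected at the next symbol of the
  string; the next failure value is looked up in the failure row. The last state has no next symbol
  and keeps the plain copy.\<close>

definition next_row :: com where
  "next_row =
     Put1 Fail (Var Ix) (Var Fl) ;;
     copy_row ;;
     Cond (Var Ix) (Var Len)
      (Sym ::= symbol_at (Var Ix) ;;
       Fl ::= Get Delta (Var Fl) (Var Sym) ;;
       Put Delta (Var Ix) (Var Sym) (Pls (Var Ix) (Lit 1)))
      Skip ;;
     incr Ix"

definition build_automaton :: com where
  "build_automaton =
     Put Delta (Lit 0) (symbol_at (Lit 0)) (Lit 1) ;;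
     Ix ::= Lit 1 ;;
     Fl ::= Lit 0 ;;
     Loop (Var Ix) (Pls (Var Len) (Lit 1)) next_row"

text \<open>States are visited downwards, so children precede parents; each state overwrites the
  colour of its parent with its own.\<close>

definition colour_state :: com where
  "colour_state =
     Ix ::= Mns (Var Ix) (Lit 1) ;;
     Cond (Lit 0) (Get1 Chain (Var Ix)) Skip
      (incr Wid ;; Put1 Chain (Var Ix) (Var Wid)) ;;
     Put1 Chain (Get1 Fail (Var Ix)) (Get1 Chain (Var Ix))"

definition colour_states :: com where
  "colour_states =
     Ix ::= Pls (Var Len) (Lit 1) ;;
     Wid ::= Lit 0 ;;
     Loop (Lit 0) (Var Ix) colour_state"

text \<open>A match may start at any vertex, so each row begins with the state reached by the label
  alone. If that state is 0, the write just leaves the slot empty.\<close>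

definition init_vertex :: com where
  "init_vertex =
     St ::= Get Delta (Lit 0) (label_of (Var Ix)) ;;
     Put Mark (Var Ix) (Get1 Chain (Var St)) (Var St) ;;
     Cond (Get1 Deg (Var Ix)) (Lit 1) (Put1 Queue (Var Back) (Var Ix) ;; incr Back) Skip ;;
     incr Ix"

definition init_vertices :: com where
  "init_vertices = Ix ::= Lit 0 ;; Back ::= Lit 0 ;; Loop (Var Ix) (Var NumV) init_vertex"

definition relax_slot :: com where
  "relax_slot =
     St ::= Get Delta (Get Mark (Var Src) (Var Slot)) (Var Sym) ;;
     Cond (Get Mark (Var Dst) (Get1 Chain (Var St))) (Var St)
       (Put Mark (Var Dst) (Get1 Chain (Var St)) (Var St)) Skip ;;
     incr Slot"

definition relax :: com where
  "relax = Slot ::= Lit 1 ;; Loop (Var Slot) (Pls (Var Wid) (Lit 1)) relax_slot"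

definition process_edge :: com where
  "process_edge =
     Dst ::= target_of (Mns (Var Edge) (Lit 1)) ;;
     Sym ::= label_of (Var Dst) ;;
     relax ;;
     Put1 Deg (Var Dst) (Mns (Get1 Deg (Var Dst)) (Lit 1)) ;;
     Cond (Get1 Deg (Var Dst)) (Lit 1) (Put1 Queue (Var Back) (Var Dst) ;; incr Back) Skip ;;
     Edge ::= Get1 Next (Var Edge)"

definition process_vertex :: com where
  "process_vertex =
     Src ::= Get1 Queue (Var Front) ;;
     incr Front ;;
     Edge ::= Get1 Head (Var Src) ;;
     Loop (Lit 0) (Var Edge) process_edge"

definition propagate :: com where
  "propagate = Front ::= Lit 0 ;; Loop (Var Front) (Var Back) process_vertex"

definition scan_vertex :: com where
  "scan_vertex =
     Cond (Get Mark (Var Ix) (Get1 Chain (Var Len))) (Var Len) Skip (Ans ::= Lit 1) ;; incr Ix"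

definition scan :: com where
  "scan = Ix ::= Lit 0 ;; Loop (Var Ix) (Var NumV) scan_vertex"

text \<open>The empty string is treated apart: it labels the empty path, and the automaton needs a
  first symbol.\<close>

definition matcher :: com where
  "matcher =
     NumV ::= Inp (Lit 0) ;; NumE ::= Inp (Lit 1) ;; NumA ::= Inp (Lit 2) ;; Len ::= Inp (Lit 3) ;;
     Cond (Lit 0) (Var Len)
      (link_edges ;; build_automaton ;; colour_states ;; init_vertices ;; propagate ;; scan)
      (Ans ::= Lit 1)"

section \<open>Correctness and running time of preprocessing\<close>

locale matching = machine + labelled_dag +
  fixes \<sigma> :: nat
  assumes inp_sizes: "inp 0 = n" "inp 1 = e" "inp 2 = \<sigma>" "inp 3 = length T"
    and inp_label: "v < n \<Longrightarrow> inp (4 + v) = lb v"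
    and inp_source: "j < e \<Longrightarrow> inp (4 + n + (j + j)) = src j"
    and inp_target: "j < e \<Longrightarrow> inp (5 + n + (j + j)) = dst j"
    and inp_symbol: "i < length T \<Longrightarrow> inp (4 + n + (e + e + i)) = T ! i"
    and label_less: "v < n \<Longrightarrow> lb v < \<sigma>" and symbol_less: "i < length T \<Longrightarrow> T ! i < \<sigma>"
    and Q_eq: "Q = n + 2 * e + \<sigma> + length T + 8"
begin

lemma Q_ge: "n + 2 * e + \<sigma> + m + 8 \<le> Q"
  using Q_eq by simp

definition sizes :: "store \<Rightarrow> bool" where
  "sizes s \<longleftrightarrow> vr s NumV = n \<and> vr s NumE = e \<and> vr s NumA = \<sigma> \<and> vr s Len = m"

lemma sizes_frame:
  assumes "frame c s s'" "{NumV, NumE, NumA, Len} \<inter> written_vars c = {}"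
  shows "sizes s' \<longleftrightarrow> sizes s"
  using frame_vr[OF assms(1)] assms(2) by (auto simp: sizes_def)

lemma wp_link_edges:
  assumes "sizes s" "ar s Head = (\<lambda>_ _. 0)" "ar s Deg = (\<lambda>_ _. 0)"
  shows "wp link_edges (\<lambda>s'. (\<forall>u. ar s' Head u 0 = prev src e u)
    \<and> (\<forall>j < e. ar s' Next (Suc j) 0 = prev src j (src j))
    \<and> (\<forall>v. ar s' Deg v 0 = card {j. j < e \<and> dst j = v})
    \<and> tm s' \<le> tm s + 7 * e + 2) s"
  unfolding link_edges_def wp_simps
proof (intro conjI)
  show "wp (Loop (Var Ix) (Var NumE) link_edge) (\<lambda>s'. (\<forall>u. ar s' Head u 0 = prev src e u)
    \<and> (\<forall>j < e. ar s' Next (Suc j) 0 = prev src j (src j))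
    \<and> (\<forall>v. ar s' Deg v 0 = card {j. j < e \<and> dst j = v})
    \<and> tm s' \<le> tm s + 7 * e + 2) (upd Ix (eval (Lit 0) s) s)"
    (is "wp _ _ ?s")
  proof (rule wp_Loop[where \<mu> = "\<lambda>s. e - vr s Ix" and I = "\<lambda>s'. vr s' Ix \<le> e
      \<and> (\<forall>u. ar s' Head u 0 = prev src (vr s' Ix) u)
      \<and> (\<forall>j < vr s' Ix. ar s' Next (Suc j) 0 = prev src j (src j))
      \<and> (\<forall>v. ar s' Deg v 0 = card {j. j < vr s' Ix \<and> dst j = v})
      \<and> tm s' \<le> tm s + 7 * vr s' Ix + 1"], goal_cases)
    case (3 t)
    have sz: "vr t NumV = n" "vr t NumE = e"
      using frame_vr[OF 3(2)] assms(1) by (auto simp: sizes_def link_edge_def)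
    define i where "i = vr t Ix"
    have i: "i < e"
      using 3(3) sz by (simp add: i_def)
    \<comment> \<open>The in-degree seen so far is at most \<open>i\<close>, so incrementing it
      stays below \<open>Q\<close>.\<close>
    have "card {j. j < i \<and> dst j = v} \<le> card {..<i}" for v
      by (intro card_mono) auto
    then have c: "card {j. j < i \<and> dst j = v} \<le> i" for v
      by simp
    have "{j. j < Suc i \<and> dst j = v}
        = (if dst i = v then insert i {j. j < i \<and> dst j = v} else {j. j < i \<and> dst j = v})" for v
      by (auto simp: less_Suc_eq)
    then have d: "card {j. j < Suc i \<and> dst j = v}
        = (if dst i = v then Suc (card {j. j < i \<and> dst j = v}) else card {j. j < i \<and> dst j = v})" for v
      by simp
    have I: "\<forall>u. ar t Head u 0 = prev src i u"
        "\<forall>j < i. ar t Next (Suc j) 0 = prev src j (src j)"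
        "\<forall>v. ar t Deg v 0 = card {j. j < i \<and> dst j = v}" "tm t \<le> tm s + 7 * i + 1"
      using 3(1) by (simp_all add: i_def)
    note [simp] = inp_source[OF i, simplified] inp_target[OF i, simplified] sz i_def[symmetric] d[unfolded less_Suc_eq]
    show ?case
      using I i src_less[OF i] dst_less[OF i] c[of "dst i"] Q_ge
      by (auto simp: link_edge_def less_Suc_eq)
  qed (use assms in \<open>auto simp: sizes_def link_edge_def dest: frame_vr[where x = NumE]\<close>)
qed (use Q8 in simp_all)

text \<open>The two row indices must differ, otherwise the copy would overwrite what it reads; in
  use, the failure state is smaller.\<close>

lemma wp_copy_row:
  assumes "sizes s" "vr s Fl \<noteq> vr s Ix" "vr s Fl < Q" "vr s Ix < Q"
  shows "wp copy_row (\<lambda>s'. (\<forall>a < \<sigma>. ar s' Delta (vr s Ix) a = ar s Delta (vr s Fl) a)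
    \<and> (\<forall>i. i \<noteq> vr s Ix \<longrightarrow> ar s' Delta i = ar s Delta i) \<and> tm s' \<le> tm s + 3 * \<sigma> + 2) s"
    (is "wp _ ?P s")
proof -
  let ?c = "Put Delta (Var Ix) (Var Sym) (Get Delta (Var Fl) (Var Sym)) ;; incr Sym"
  have "wp (Loop (Var Sym) (Var NumA) ?c) ?P (upd Sym 0 s)"
  proof (rule wp_Loop[where \<mu> = "\<lambda>t. \<sigma> - vr t Sym" and I = "\<lambda>t. vr t Sym \<le> \<sigma>
      \<and> (\<forall>a < vr t Sym. ar t Delta (vr s Ix) a = ar s Delta (vr s Fl) a)
      \<and> (\<forall>i. i \<noteq> vr s Ix \<longrightarrow> ar t Delta i = ar s Delta i)
      \<and> tm t \<le> tm s + 3 * vr t Sym + 1"], goal_cases)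
    case (3 t)
    have "vr t NumA = \<sigma>" "vr t Ix = vr s Ix" "vr t Fl = vr s Fl"
      using frame_vr[OF 3(2)] assms(1) by (auto simp: sizes_def)
    then show ?case
      using 3 assms Q_ge by (auto simp: less_Suc_eq)
  qed (use assms in \<open>auto simp: sizes_def dest: frame_vr[where x = NumA]\<close>)
  then show ?thesis
    using Q8 by (simp add: copy_row_def)
qed

lemma wp_next_row:
  assumes sz: "sizes s" and i: "1 \<le> vr s Ix" "vr s Ix \<le> m"
    and rows: "\<forall>i < vr s Ix. \<forall>a < \<sigma>. ar s Delta i a = delta T i a"
    and fl: "vr s Fl = failure T (vr s Ix)"
  shows "wp next_row (\<lambda>s'. vr s' Ix = Suc (vr s Ix)
    \<and> (\<forall>i < vr s' Ix. \<forall>a < \<sigma>. ar s' Delta i a = delta T i a)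
    \<and> (vr s' Ix \<le> m \<longrightarrow> vr s' Fl = failure T (vr s' Ix))
    \<and> ar s' Fail = (ar s Fail)(vr s Ix := (ar s Fail (vr s Ix))(0 := vr s Fl))
    \<and> tm s' \<le> tm s + 3 * \<sigma> + 8) s"
    (is "wp _ ?P s")
proof -
  define i where "i = vr s Ix"
  have i': "1 \<le> i" "i \<le> m" "i < Q" "0 < Q"
    using i Q_ge by (simp_all add: i_def)
  have f: "failure T i < i"
    using failure_less[OF i'(1,2)] .
  let ?s = "put Fail i 0 (vr s Fl) s"
  have "wp copy_row (\<lambda>s'. (\<forall>a < \<sigma>. ar s' Delta (vr ?s Ix) a = ar ?s Delta (vr ?s Fl) a)
    \<and> (\<forall>i. i \<noteq> vr ?s Ix \<longrightarrow> ar s' Delta i = ar ?s Delta i) \<and> tm s' \<le> tm ?s + 3 * \<sigma> + 2) ?s"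
    using sz fl f i' by (intro wp_copy_row) (auto simp: sizes_def i_def)
  then have "wp copy_row (wp (Cond (Var Ix) (Var Len)
      (Sym ::= symbol_at (Var Ix) ;;
       Fl ::= Get Delta (Var Fl) (Var Sym) ;;
       Put Delta (Var Ix) (Var Sym) (Pls (Var Ix) (Lit 1)))
      Skip ;; incr Ix) ?P) ?s"
  proof (rule wp_mono)
    fix t assume t: "(\<forall>a < \<sigma>. ar t Delta (vr ?s Ix) a = ar ?s Delta (vr ?s Fl) a)
      \<and> (\<forall>i. i \<noteq> vr ?s Ix \<longrightarrow> ar t Delta i = ar ?s Delta i) \<and> tm t \<le> tm ?s + 3 * \<sigma> + 2"
      and fr: "frame copy_row ?s t"
    have v: "vr t NumV = n" "vr t NumE = e" "vr t Len = m" "vr t Ix = i" "vr t Fl = failure T i"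
      using frame_vr[OF fr] sz fl by (auto simp: sizes_def copy_row_def i_def)
    have fa: "ar t Fail = ar ?s Fail"
      using frame_ar[OF fr] by (simp add: copy_row_def)
    have row: "ar t Delta i a = delta T (failure T i) a" if "a < \<sigma>" for a
      using t rows f fl that by (simp add: i_def)
    have old: "ar t Delta k a = delta T k a" if "k < i" "a < \<sigma>" for k a
      using t rows that by (simp add: i_def)
    show "wp (Cond (Var Ix) (Var Len)
      (Sym ::= symbol_at (Var Ix) ;;
       Fl ::= Get Delta (Var Fl) (Var Sym) ;;
       Put Delta (Var Ix) (Var Sym) (Pls (Var Ix) (Lit 1)))
      Skip ;; incr Ix) ?P t"
    proof (cases "i < m")
      case True
      \<comment> \<open>The copied row is right everywhere except at the symbol
        \<open>T ! i\<close>, which the final write corrects.\<close>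
      have "delta T i a = (if a = T ! i then Suc i else delta T (failure T i) a)" for a
        using delta_next[OF True] delta_failure[of i T a] i' by auto
      then have "ar t Delta i a = delta T i a" if "a < \<sigma>" "a \<noteq> T ! i" for a
        using row that by simp
      then show ?thesis
        using t True v fa old[OF f] old f i' symbol_less[OF True] Q_ge delta_next[OF True]
          failure_Suc[of i T]
        by (auto simp: less_Suc_eq i_def[symmetric] inp_symbol[OF True, simplified])
    next
      case False
      then have "delta T i a = delta T (failure T i) a" for a
        using i' by (intro delta_failure) auto
      then show ?thesis
        using t False v fa old row i' Q_ge by (auto simp: less_Suc_eq i_def[symmetric])
    qed
  qed
  then show ?thesis
    using i' by (simp add: next_row_def i_def)
qed

lemma wp_build_automaton:
  assumes sz: "sizes s" and "ar s Delta = (\<lambda>_ _. 0)" "ar s Fail = (\<lambda>_ _. 0)"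
  shows "wp build_automaton (\<lambda>s'. (\<forall>i \<le> m. \<forall>a < \<sigma>. ar s' Delta i a = delta T i a)
    \<and> (\<forall>i. 1 \<le> i \<longrightarrow> i \<le> m \<longrightarrow> ar s' Fail i 0 = failure T i) \<and> ar s' Fail 0 0 = 0
    \<and> tm s' \<le> tm s + m * (3 * \<sigma> + 9) + 4) s"
    (is "wp _ ?P s")
proof -
  have m: "0 < m"
    using T_nonempty by simp
  let ?s = "upd Fl 0 (upd Ix 1 (put Delta 0 (T ! 0) 1 s))"
  have "wp (Loop (Var Ix) (Pls (Var Len) (Lit 1)) next_row) ?P ?s"
  proof (rule wp_Loop[where \<mu> = "\<lambda>t. Suc m - vr t Ix" and I = "\<lambda>t. 1 \<le> vr t Ix \<and> vr t Ix \<le> Suc m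
      \<and> (\<forall>i < vr t Ix. \<forall>a < \<sigma>. ar t Delta i a = delta T i a)
      \<and> (vr t Ix \<le> m \<longrightarrow> vr t Fl = failure T (vr t Ix))
      \<and> (\<forall>i. 1 \<le> i \<longrightarrow> i < vr t Ix \<longrightarrow> ar t Fail i 0 = failure T i) \<and> ar t Fail 0 0 = 0
      \<and> tm t \<le> tm s + (vr t Ix - 1) * (3 * \<sigma> + 9) + 3"], goal_cases)
    case 1
    then show ?case
      using assms T_nonempty failure_1 m by (auto simp: delta_zero)
  next
    case (2 t)
    then have "vr t Len = m"
      using frame_vr[OF 2(2)] sz by (auto simp: sizes_def next_row_def copy_row_def)
    then show ?case
      using Q_ge by simp
  next
    case (3 t)
    have szt: "sizes (tick t)"
      using sizes_frame[OF 3(2)] sz by (simp add: sizes_def next_row_def copy_row_def)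
    then have i: "1 \<le> vr t Ix" "vr t Ix \<le> m"
      using 3 by (auto simp: sizes_def)
    have "vr t Ix * (3 * \<sigma> + 9) = (vr t Ix - 1) * (3 * \<sigma> + 9) + (3 * \<sigma> + 9)"
      using i by (cases "vr t Ix") auto
    moreover have "wp next_row (\<lambda>s'. vr s' Ix = Suc (vr t Ix)
      \<and> (\<forall>i < vr s' Ix. \<forall>a < \<sigma>. ar s' Delta i a = delta T i a)
      \<and> (vr s' Ix \<le> m \<longrightarrow> vr s' Fl = failure T (vr s' Ix))
      \<and> ar s' Fail = (ar t Fail)(vr t Ix := (ar t Fail (vr t Ix))(0 := vr t Fl))
      \<and> tm s' \<le> Suc (tm t) + 3 * \<sigma> + 8) (tick t)"
      using wp_next_row[OF szt] i 3 by simp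
    ultimately show ?case
      using i 3(1) by (elim wp_mono) (auto simp: less_Suc_eq)
  next
    case (4 t)
    then have "vr t Len = m"
      using frame_vr[OF 4(2)] sz by (auto simp: sizes_def next_row_def copy_row_def)
    then have "vr t Ix = Suc m"
      using 4 by auto
    then show ?case
      using 4 by (auto simp: less_Suc_eq_le)
  qed
  then show ?thesis
    using Q_ge sz inp_symbol[OF m, simplified] symbol_less[OF m]
    by (simp add: build_automaton_def sizes_def)
qed

lemma wp_colour_states:
  assumes sz: "sizes s" and "ar s Chain = (\<lambda>_ _. 0)"
    and fail: "\<forall>i. 1 \<le> i \<longrightarrow> i \<le> m \<longrightarrow> ar s Fail i 0 = failure T i" "ar s Fail 0 0 = 0"
  shows "wp colour_states (\<lambda>s'. colouring T 0 (\<lambda>k. ar s' Chain k 0) (vr s' Wid)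
    \<and> tm s' \<le> tm s + 6 * m + 9) s"
    (is "wp _ ?P s")
proof -
  let ?s = "upd Wid 0 (upd Ix (Suc m) s)"
  have "wp (Loop (Lit 0) (Var Ix) colour_state) ?P ?s"
  proof (rule wp_Loop[where \<mu> = "\<lambda>t. vr t Ix" and I = "\<lambda>t. vr t Ix \<le> Suc m
      \<and> colouring T (vr t Ix) (\<lambda>k. ar t Chain k 0) (vr t Wid)
      \<and> tm t + 6 * vr t Ix \<le> tm s + 6 * m + 8"], goal_cases)
    case 1
    then show ?case
      using assms(2) colouring_init[of T] by simp
  next
    case (3 t)
    define i where "i = vr t Ix - 1"
    have i: "vr t Ix = Suc i" "i \<le> m"
      using 3 by (auto simp: i_def)
    have c: "colouring T (Suc i) (\<lambda>k. ar t Chain k 0) (vr t Wid)"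
      using 3 i by simp
    have "vr t Wid = card {l \<in> {Suc i..m}. leaf T l}"
      using c by (simp add: colouring_def)
    \<comment> \<open>State 0 has not been treated, so at most \<open>m\<close> colours exist and
      opening another stays below \<open>Q\<close>.\<close>
    also have "\<dots> \<le> card {1..m}"
      by (intro card_mono) auto
    finally have wid: "vr t Wid \<le> m"
      by simp
    define p where "p = (if i = 0 then 0 else failure T i)"
    have "ar t Fail = ar s Fail"
      using frame_ar[OF 3(2)] by (simp add: colour_state_def)
    then have p: "ar t Fail i 0 = p"
      using fail i by (simp add: p_def)
    have "p \<le> i"
      using failure_less[of i T] i by (auto simp: p_def)
    have cong: "colouring T i g x" if "colouring T i f x" "\<And>k. g k = f k" for f g x
    proof -
      have "g = f"
        using that(2) by (rule ext)
      then show ?thesis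
        using that(1) by simp
    qed
    note step = colouring_step[OF c i(2) refl refl p_def]
    show ?case
      using 3(1) i wid p \<open>p \<le> i\<close> step Q_ge
      by (auto simp: colour_state_def split: if_splits elim!: cong)
  qed (use Q8 in auto)
  then show ?thesis
    using Q_ge sz by (simp add: colour_states_def sizes_def)
qed

end

section \<open>Correctness and running time of the propagation\<close>

locale coloured_matching = matching + coloured_dag +
  assumes w_le: "w \<le> Suc (length T)"
begin

text \<open>The data that no later stage modifies, so \<open>tables_frame\<close> carries it through
  all remaining loops.\<close>

definition tables :: "store \<Rightarrow> bool" where
  "tables s \<longleftrightarrow> sizes s \<and> vr s Wid = w
     \<and> (\<forall>i \<le> m. \<forall>a < \<sigma>. ar s Delta i a = delta T i a) \<and> (\<forall>k. ar s Chain k 0 = ch k)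
     \<and> (\<forall>u. ar s Head u 0 = prev src e u)
     \<and> (\<forall>j < e. ar s Next (Suc j) 0 = prev src j (src j))"

lemma tables_frame:
  assumes "frame c s s'" "{NumV, NumE, NumA, Len, Wid} \<inter> written_vars c = {}"
    "{Delta, Chain, Head, Next} \<inter> written_arrs c = {}"
  shows "tables s' \<longleftrightarrow> tables s"
  using frame_vr[OF assms(1)] frame_ar[OF assms(1)] assms(2,3) by (auto simp: tables_def sizes_def)

lemma tables_tick [simp]: "tables (tick s) = tables s"
  by (simp add: tables_def sizes_def)

definition queue :: "store \<Rightarrow> nat \<Rightarrow> nat" where
  "queue s = (\<lambda>i. ar s Queue i 0)"

definition degree :: "store \<Rightarrow> nat \<Rightarrow> nat" where
  "degree s = (\<lambda>v. ar s Deg v 0)"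

lemma queue_simps [simp]:
  "queue (upd x i s) = queue s" "queue (tick s) = queue s"
  "queue (put k i 0 j s) = (if k = Queue then (queue s)(i := j) else queue s)"
  "k \<noteq> Queue \<Longrightarrow> queue (put k i l j s) = queue s"
  by (auto simp: queue_def)

lemma degree_simps [simp]:
  "degree (upd x i s) = degree s" "degree (tick s) = degree s"
  "degree (put k i 0 j s) = (if k = Deg then (degree s)(i := j) else degree s)"
  "k \<noteq> Deg \<Longrightarrow> degree (put k i l j s) = degree s"
  by (auto simp: degree_def)

abbreviation kahn_state :: "nat set \<Rightarrow> store \<Rightarrow> bool" where
  "kahn_state D s \<equiv> kahn D (ar s Mark) (degree s) (queue s) (vr s Back)"

lemma state_bounds:
  assumes "k \<le> m"
  shows "k < Q" "ch k < Q"
  using assms ch_le[of k] w_le Q_ge by linarith+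

lemma wp_init_vertices:
  assumes tb: "tables s" and "ar s Mark = (\<lambda>_ _. 0)"
    and deg: "\<forall>v. degree s v = card {j. j < e \<and> dst j = v}"
  shows "wp init_vertices (\<lambda>s'. kahn_state {} s' \<and> tm s' \<le> tm s + 7 * n + 3) s"
    (is "wp _ ?P s")
proof -
  let ?s = "upd Back 0 (upd Ix 0 s)"
  let ?row = "\<lambda>v. merge (\<lambda>_. 0) (delta T 0 (lb v))"
  have "wp (Loop (Var Ix) (Var NumV) init_vertex) ?P ?s"
  proof (rule wp_Loop[where \<mu> = "\<lambda>t. n - vr t Ix" and I = "\<lambda>t. vr t Ix \<le> n \<and> vr t Back \<le> vr t Ix
      \<and> (\<forall>v < vr t Ix. ar t Mark v = ?row v) \<and> (\<forall>v \<ge> vr t Ix. ar t Mark v = (\<lambda>_. 0))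
      \<and> inj_on (queue t) {..<vr t Back}
      \<and> queue t ` {..<vr t Back} = {v. v < vr t Ix \<and> degree s v = 0}
      \<and> tm t \<le> tm s + 7 * vr t Ix + 2"], goal_cases)
    case 1
    then show ?case
      using assms(2) by simp
  next
    case (2 t)
    then show ?case by simp
  next
    case (3 t)
    have tbt: "tables t"
      using tables_frame[OF 3(2)] tb by (auto simp: init_vertex_def tables_def sizes_def)
    have dg: "degree t = degree s"
      using frame_ar[OF 3(2), of Deg] by (simp add: init_vertex_def degree_def)
    define i b where "i = vr t Ix" and "b = vr t Back"
    have i: "i < n" "b \<le> i"
      using 3 tbt by (simp_all add: i_def b_def tables_def sizes_def)
    define d where "d = delta T 0 (lb i)"
    have D: "ar t Delta 0 (lb i) = d"
      using tbt label_less[OF i(1)] by (simp add: tables_def d_def)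
    have dm: "d \<le> m"
      by (simp add: d_def delta_le)
    \<comment> \<open>The program writes unconditionally, whereas \<open>merge\<close> tests; on an
      empty row the results agree even for \<open>d = 0\<close>.\<close>
    have row: "(\<lambda>_. 0)(ch d := d) = ?row i"
      by (auto simp: merge_def d_def)
    have ch: "\<forall>k. ar t Chain k 0 = ch k"
      using tbt by (simp add: tables_def)
    have old: "\<forall>v < i. ar t Mark v = ?row v" "\<forall>v \<ge> i. ar t Mark v = (\<lambda>_. 0)"
      "inj_on (queue t) {..<b}" "queue t ` {..<b} = {v. v < i \<and> degree s v = 0}"
      "tm t \<le> tm s + 7 * i + 2"
      using 3(1) by (simp_all add: i_def b_def)
    have "inj_on ((queue t)(b := i)) {..<b}"
      using old(3) by (simp add: inj_on_def)
    moreover have "i \<notin> queue t ` {..<b}"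
      unfolding old(4) by simp
    ultimately have inj: "inj_on ((queue t)(b := i)) {..<Suc b}"
        "(queue t)(b := i) ` {..<Suc b} = insert i (queue t ` {..<b})"
      by (auto simp: lessThan_Suc)
    have dgi: "ar t Deg i 0 = degree s i"
      using dg by (metis degree_def)
    have z: "ar t Mark i = (\<lambda>_. 0)"
      using old(2) by simp
    have bd: "i < Q" "b < Q" "lb i < Q" "d < Q" "ch d < Q" "Suc b < Q" "Suc i < Q" "0 < Q"
        "Suc 0 < Q" "4 + i < Q" "4 < Q"
      using i Q_ge dm label_less[OF i(1)] state_bounds[OF dm] by linarith+
    have "wp init_vertex (\<lambda>t'. vr t' Ix = Suc i \<and> ar t' Mark = (ar t Mark)(i := ?row i)
        \<and> (if degree s i = 0
           then queue t' = (queue t)(b := i) \<and> vr t' Back = Suc b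
           else queue t' = queue t \<and> vr t' Back = b) \<and> tm t' \<le> tm t + 7) (tick t)"
      using bd by (simp add: init_vertex_def i_def[symmetric] b_def[symmetric] inp_label[OF i(1)]
          D ch z dgi row[symmetric])
    then show ?case
    proof (rule wp_mono, goal_cases)
      case (1 t')
      have "{v. v < Suc i \<and> degree s v = 0} = (if degree s i = 0
          then insert i {v. v < i \<and> degree s v = 0} else {v. v < i \<and> degree s v = 0})"
        by (auto simp: less_Suc_eq)
      then have "inj_on (queue t') {..<vr t' Back}" "vr t' Back \<le> Suc i"
          "queue t' ` {..<vr t' Back} = {v. v < Suc i \<and> degree s v = 0}"
        using 1 inj old(3,4) i(2) by (simp_all split: if_splits)
      then show ?case
        using 1 i old(1,2,5) by (auto simp: i_def[symmetric] less_Suc_eq)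
    qed
  next
    case (4 t)
    have tbt: "tables t"
      using tables_frame[OF 4(2)] tb by (auto simp: init_vertex_def tables_def sizes_def)
    have dg: "degree t = degree s"
      using frame_ar[OF 4(2), of Deg] by (simp add: init_vertex_def degree_def)
    have n: "vr t Ix = n"
      using 4 tbt by (simp add: tables_def sizes_def)
    have rows: "row v (?row v) \<and> covers (?row v) (delta T 0 (lb v))" if "v < n" for v
    proof -
      have r: "reach v (delta T 0 (lb v))" if "delta T 0 (lb v) \<noteq> 0"
        by (rule reach_step[OF \<open>v < n\<close> _ that delta_suffix]) simp
      show ?thesis
        using row_merge[OF row_zero delta_le r] covers_merge[OF row_zero delta_le r] by simp
    qed
    have "kahn_state {} t"
      unfolding kahn_def using 4(1) rows deg by (simp add: n dg)
    then show ?case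
      using 4(1) by (simp add: n)
  qed
  then show ?thesis
    using Q_ge by (simp add: init_vertices_def)
qed

text \<open>Since source and target differ, the row being read stays fixed while the other is
  updated slot by slot.\<close>

lemma wp_relax:
  assumes tb: "tables s" and j: "j < e" "src j = vr s Src" "dst j = vr s Dst" "src j \<noteq> dst j"
    and sym: "vr s Sym = lb (dst j)"
    and rows: "\<forall>v < n. row v (ar s Mark v)"
  shows "wp relax (\<lambda>t. (\<exists>y. ar t Mark = (ar s Mark)(dst j := y) \<and> row (dst j) y
      \<and> extends (ar s Mark (dst j)) y
      \<and> (\<forall>c \<in> {1..w}. covers y (delta T (ar s Mark (src j) c) (lb (dst j)))))
      \<and> tm t \<le> tm s + 6 * w + 2) s"
    (is "wp _ ?P s")
proof -
  define u v where "u = src j" and "v = dst j"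
  have uv: "u < n" "v < n" "u \<noteq> v"
    using j(4) src_less[OF j(1)] dst_less[OF j(1)] by (simp_all add: u_def v_def)
  let ?d = "\<lambda>c. delta T (ar s Mark u c) (lb v)"
  have "wp (Loop (Var Slot) (Pls (Var Wid) (Lit 1)) relax_slot) ?P (upd Slot 1 s)"
  proof (rule wp_Loop[where \<mu> = "\<lambda>t. Suc w - vr t Slot" and I = "\<lambda>t. 1 \<le> vr t Slot \<and> vr t Slot \<le> Suc w
      \<and> ar t Mark = (ar s Mark)(v := ar t Mark v) \<and> row v (ar t Mark v)
      \<and> extends (ar s Mark v) (ar t Mark v)
      \<and> (\<forall>c \<in> {1..<vr t Slot}. covers (ar t Mark v) (?d c))
      \<and> tm t + 5 \<le> tm s + 6 * vr t Slot"], goal_cases)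
    case 1
    then show ?case
      using rows uv by (simp add: extends_refl)
  next
    case (2 t)
    then show ?case
      using frame_vr[OF 2(2), of Wid] tb w_le Q_ge by (simp add: relax_slot_def tables_def)
  next
    case (3 t)
    have tbt: "tables t"
      using tables_frame[OF 3(2)] tb by (auto simp: relax_slot_def tables_def sizes_def)
    have vs: "vr t Src = u" "vr t Dst = v" "vr t Sym = lb v"
      using frame_vr[OF 3(2)] j sym by (auto simp: relax_slot_def u_def v_def)
    define c where "c = vr t Slot"
    have c: "c \<le> w" "1 \<le> c"
      using 3 tbt by (auto simp: tables_def c_def)
    define x where "x = ar s Mark u c"
    have "ar t Mark u = ar s Mark u"
      using 3(1) uv(3) by (metis fun_upd_other)
    then have x: "ar t Mark u c = x"
      by (simp add: x_def)
    have xr: "x \<le> m" "x \<noteq> 0 \<Longrightarrow> reach u x"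
      using rows uv by (auto simp: row_def x_def)
    define d where "d = delta T x (lb v)"
    have D: "ar t Delta x (lb v) = d"
      using tbt xr label_less[OF uv(2)] by (simp add: tables_def d_def)
    have dm: "d \<le> m"
      by (simp add: d_def delta_le)
    have "reach v d" if "d \<noteq> 0"
    proof (rule reach_step[OF uv(2) _ that])
      show "x = 0 \<or> (\<exists>j < e. dst j = v \<and> reach (src j) x)"
        using xr(2) j(1) by (auto simp: u_def v_def)
      show "suffix (take d T) (take x T @ [lb v])"
        unfolding d_def by (rule delta_suffix)
    qed
    define y where "y = ar t Mark v"
    have old: "ar t Mark = (ar s Mark)(v := y)" "row v y" "extends (ar s Mark v) y"
      "\<forall>c' \<in> {1..<c}. covers y (?d c')" "tm t + 5 \<le> tm s + 6 * c"
      using 3(1) unfolding y_def c_def by blast+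
    note mg = row_merge[OF old(2) dm \<open>d \<noteq> 0 \<Longrightarrow> reach v d\<close>]
      extends_merge[OF old(2) dm \<open>d \<noteq> 0 \<Longrightarrow> reach v d\<close>]
      covers_merge[OF old(2) dm \<open>d \<noteq> 0 \<Longrightarrow> reach v d\<close>]
    have ch: "\<forall>k. ar t Chain k 0 = ch k"
      using tbt by (simp add: tables_def)
    let ?y = "merge y d"
    have ext: "extends (ar s Mark v) ?y"
      using extends_trans[OF old(3) mg(2)] .
    have cov: "\<forall>c' \<in> {1..<Suc c}. covers ?y (?d c')"
    proof
      fix c' assume c': "c' \<in> {1..<Suc c}"
      show "covers ?y (?d c')"
      proof (cases "c' = c")
        case True
        then show ?thesis
          using mg(3) by (simp add: d_def x_def)
      next
        case False
        then have "c' \<in> {1..<c}"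
          using c' by simp
        then show ?thesis
          using old(4) covers_extends[OF _ mg(2)] by blast
      qed
    qed
    have bd: "u < Q" "v < Q" "c < Q" "lb v < Q" "x < Q" "d < Q" "ch d < Q" "Suc c < Q" "0 < Q" "1 < Q"
      using uv c w_le Q_ge xr(1) dm label_less[OF uv(2)] state_bounds[OF dm] by linarith+
    have "wp relax_slot (\<lambda>t'. vr t' Slot = Suc c \<and> ar t' Mark = (ar t Mark)(v := ?y)
        \<and> tm t' \<le> tm t + 5) (tick t)"
      using bd by (auto simp: relax_slot_def vs c_def[symmetric] x D ch y_def[symmetric] merge_def)
    then show ?case
      using c ext cov mg(1) old(1,5) by (elim wp_mono) (simp add: c_def[symmetric])
  next
    case (4 t)
    then have "vr t Wid = w"
      using frame_vr[OF 4(2), of Wid] tb by (simp add: relax_slot_def tables_def)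
    then have "vr t Slot = Suc w"
      using 4 by simp
    then show ?case
      using 4(1) by (auto simp: u_def v_def atLeastLessThanSuc_atLeastAtMost
          intro!: exI[of _ "ar t Mark (dst j)"])
  qed
  then show ?thesis
    using Q_ge by (simp add: relax_def)
qed

lemma wp_process_edge:
  assumes tb: "tables s" and k: "kahn_state D s"
    and j: "j < e" "j \<notin> D" "src j = vr s Src" "src j \<in> queue s ` {..<vr s Back}"
    and ed: "vr s Edge = Suc j"
  shows "wp process_edge (\<lambda>t. kahn_state (insert j D) t \<and> vr t Edge = prev src j (src j)
    \<and> vr s Back \<le> vr t Back \<and> (\<forall>i < vr s Back. queue t i = queue s i)
    \<and> tm t \<le> tm s + 6 * w + 10) s"
    (is "wp _ ?P s")
proof -
  define v b where "v = dst j" and "b = vr s Back"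
  have v: "v < n" "src j \<noteq> v"
    using dst_less[OF j(1)] kahn_target[OF k j(1,2)] j(4) by (auto simp: v_def)
  have b: "b \<le> n"
    using kahn_le[OF k] by (simp add: b_def)
  have sz: "vr s NumV = n"
    using tb by (simp add: tables_def sizes_def)
  have bd: "0 < Q" "Suc 0 < Q" "4 < Q" "5 < Q" "v < Q" "4 + v < Q" "b < Q" "Suc b < Q" "Suc j < Q"
      "5 + n < Q" "j + j < Q" "5 + n + (j + j) < Q"
    using v(1) b j(1) Q_ge by linarith+
  let ?s = "upd Sym (lb v) (upd Dst v s)"
  let ?rest = "Put1 Deg (Var Dst) (Mns (Get1 Deg (Var Dst)) (Lit 1)) ;;
     Cond (Get1 Deg (Var Dst)) (Lit 1) (Put1 Queue (Var Back) (Var Dst) ;; incr Back) Skip ;;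
     Edge ::= Get1 Next (Var Edge)"
  have "tables ?s"
    using tb by (simp add: tables_def sizes_def)
  moreover have rows: "\<forall>v < n. row v (ar ?s Mark v)"
    using k by (simp add: kahn_def)
  ultimately have "wp relax (\<lambda>t. (\<exists>y. ar t Mark = (ar ?s Mark)(dst j := y) \<and> row (dst j) y
      \<and> extends (ar ?s Mark (dst j)) y
      \<and> (\<forall>c \<in> {1..w}. covers y (delta T (ar ?s Mark (src j) c) (lb (dst j)))))
      \<and> tm t \<le> tm ?s + 6 * w + 2) ?s"
    using j v by (intro wp_relax) (simp_all add: v_def)
  then have "wp relax (wp ?rest ?P) ?s"
  proof (rule wp_mono)
    fix t assume "(\<exists>y. ar t Mark = (ar ?s Mark)(dst j := y) \<and> row (dst j) y
      \<and> extends (ar ?s Mark (dst j)) y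
      \<and> (\<forall>c \<in> {1..w}. covers y (delta T (ar ?s Mark (src j) c) (lb (dst j)))))
      \<and> tm t \<le> tm ?s + 6 * w + 2" and fr: "frame relax ?s t"
    then obtain y where y: "ar t Mark = (ar s Mark)(v := y)" "row v y" "extends (ar s Mark v) y"
      "\<And>c. c \<in> {1..w} \<Longrightarrow> covers y (delta T (ar s Mark (src j) c) (lb v))"
      and tm: "tm t \<le> tm s + 6 * w + 4"
      by (auto simp: v_def)
    have vt: "vr t Dst = v" "vr t Back = b" "vr t Edge = Suc j"
      using frame_vr[OF fr] ed by (simp_all add: relax_def relax_slot_def b_def)
    have at: "degree t = degree s" "queue t = queue s" "ar t Next (Suc j) 0 = prev src j (src j)"
      using frame_ar[OF fr] tb j(1)
      by (simp_all add: relax_def relax_slot_def degree_def queue_def tables_def)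
    have dg: "ar t Deg v 0 = degree s v"
      using at(1) by (metis degree_def)
    let ?deg = "(degree s)(v := degree s v - 1)"
    have "wp ?rest (\<lambda>t'. ar t' Mark = ar t Mark \<and> degree t' = ?deg
        \<and> queue t' = (if ?deg v = 0 then (queue s)(b := v) else queue s)
        \<and> vr t' Back = (if ?deg v = 0 then Suc b else b)
        \<and> vr t' Edge = prev src j (src j) \<and> tm t' \<le> tm t + 5) t"
      using bd by (simp add: vt at dg)
    then show "wp ?rest ?P t"
    proof (rule wp_mono, goal_cases)
      case (1 t')
      have "kahn (insert j D) ((ar s Mark)(v := y)) ?deg (queue t') (vr t' Back)"
        using 1 by (intro kahn_step[OF k j(1,2,4) v_def y(2-4) refl]) (auto simp: b_def)
      then show ?case
        using 1 y(1) tm by (auto simp: b_def)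
    qed
  qed
  moreover have "inp (5 + n + (j + j)) = v"
    using inp_target[OF j(1)] by (simp only: v_def)
  ultimately show ?thesis
    using bd inp_label[OF v(1)] by (simp add: process_edge_def ed sz)
qed

text \<open>The time is amortised: \<open>6 * w + 11\<close> is charged to each edge entering the
  used set, which the whole propagation does once per edge. Keeping \<open>card D\<close> on the
  left avoids subtraction.\<close>

lemma wp_process_vertex:
  assumes tb: "tables s" and f: "vr s Front < vr s Back"
    and D: "D = {j. j < e \<and> src j \<in> queue s ` {..<vr s Front}}" and k: "kahn_state D s"
  shows "wp process_vertex (\<lambda>t. vr t Front = Suc (vr s Front) \<and> vr t Front \<le> vr t Back
    \<and> (let D' = {j. j < e \<and> src j \<in> queue t ` {..<vr t Front}} in kahn_state D' t
      \<and> tm t + (6 * w + 11) * card D \<le> tm s + 4 + (6 * w + 11) * card D')) s"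
    (is "wp _ ?P s")
proof -
  define f u K where "f = vr s Front" and "u = queue s f" and "K = 6 * w + 11"
  have inj: "inj_on (queue s) {..<vr s Back}"
    using k by (simp add: kahn_def)
  have un: "u < n"
  proof -
    have "u \<in> queue s ` {..<vr s Back}"
      using f by (simp add: u_def f_def)
    then show ?thesis
      using k by (simp add: kahn_def)
  qed
  have old: "u \<notin> queue s ` {..<f}"
  proof
    assume "u \<in> queue s ` {..<f}"
    then obtain x where "x < f" "queue s f = queue s x"
      by (auto simp: u_def)
    then show False
      using inj_onD[OF inj, of f x] f by (simp add: f_def)
  qed
  have bn: "vr s Back \<le> n"
    using kahn_le[OF k] .
  \<comment> \<open>The list of \<open>u\<close> runs through decreasing indices. With
    \<open>x\<close> the current \<open>Edge\<close>, numbered from 1, the edges of \<open>u\<close>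
    already used are those with index at least \<open>x\<close>.\<close>
  let ?D = "\<lambda>x. D \<union> {j. j < e \<and> src j = u \<and> x \<le> j}"
  have De: "?D e = D"
    by auto
  \<comment> \<open>Jumping from \<open>x\<close> to the next list element passes only edges not
    leaving \<open>u\<close>, so the used set is unchanged.\<close>
  have D_gap: "?D (prev src x u) = ?D x" if "x \<le> e" for x
    using prev_gap[of src x u] prev_le[of src x u] by (auto simp: not_less) (metis le_less_linear)
  have finD: "finite (?D x)" for x
    by (simp add: D)
  let ?s = "upd Edge (prev src e u) (upd Front (Suc f) (upd Src u s))"
  have "wp (Loop (Lit 0) (Var Edge) process_edge) ?P ?s"
  proof (rule wp_Loop[where \<mu> = "\<lambda>t. vr t Edge" and I = "\<lambda>t. vr t Edge \<le> e
      \<and> (vr t Edge = 0 \<or> src (vr t Edge - 1) = u) \<and> vr s Back \<le> vr t Back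
      \<and> (\<forall>i < vr s Back. queue t i = queue s i) \<and> kahn_state (?D (vr t Edge)) t
      \<and> tm t + K * card D \<le> tm s + 3 + K * card (?D (vr t Edge))"], goal_cases)
    case 1
    have "prev src e u = 0 \<or> src (prev src e u - 1) = u"
      using prev_src[of src e u] by (cases "prev src e u") auto
    then show ?case
      using k prev_le[of src e u] D_gap[of e] De by simp
  next
    case (2 t)
    then show ?case
      using Q8 by simp
  next
    case (3 t)
    have tbt: "tables (tick t)"
      using tables_frame[OF 3(2)] tb
      by (simp add: process_edge_def relax_def relax_slot_def tables_def sizes_def)
    have fr: "vr t Src = u"
      using frame_vr[OF 3(2), of Src] by (simp add: process_edge_def relax_def relax_slot_def)
    define j where "j = vr t Edge - 1"
    have I: "vr t Edge \<le> e" "vr t Edge = 0 \<or> src (vr t Edge - 1) = u" "vr s Back \<le> vr t Back"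
      "\<forall>i < vr s Back. queue t i = queue s i" "kahn_state (?D (vr t Edge)) t"
      "tm t + K * card D \<le> tm s + 3 + K * card (?D (vr t Edge))"
      using 3(1) by - (elim conjE, assumption)+
    have j: "vr t Edge = Suc j" "j < e" "src j = u"
      using I(1,2) 3(3) by (simp_all add: j_def)
    have jD: "j \<notin> ?D (Suc j)"
      using j(3) old by (auto simp: D f_def)
    have "?D j = insert j (?D (Suc j))"
      using j(2,3) by (auto simp: Suc_le_eq le_less)
    then have ins: "?D (prev src j u) = insert j (?D (Suc j))"
      using D_gap[of j] j(2) by (metis less_imp_le)
    have uq: "u \<in> queue t ` {..<vr t Back}"
    proof
      show "u = queue t f" "f \<in> {..<vr t Back}"
        using I(3,4) f by (simp_all add: u_def f_def)
    qed
    have "card (?D (prev src j u)) = Suc (card (?D (Suc j)))"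
      unfolding ins using jD finD by (rule card_insert_disjoint[rotated])
    then have cd: "K * card (?D (prev src j u)) = K * card (?D (Suc j)) + K"
      by simp
    have "kahn_state (?D (Suc j)) (tick t)"
      using I(5) j by simp
    then have "wp process_edge (\<lambda>t'. kahn_state (insert j (?D (Suc j))) t'
      \<and> vr t' Edge = prev src j (src j)
      \<and> vr (tick t) Back \<le> vr t' Back \<and> (\<forall>i < vr (tick t) Back. queue t' i = queue (tick t) i)
      \<and> tm t' \<le> tm (tick t) + 6 * w + 10) (tick t)"
      using tbt j jD fr uq by (intro wp_process_edge) simp_all
    then show ?case
    proof (rule wp_mono, goal_cases)
      case (1 t')
      have e': "vr t' Edge = prev src j u"
        using 1 j by simp
      have "prev src j u = 0 \<or> src (prev src j u - 1) = u"
        using prev_src[of src j u] by (cases "prev src j u") auto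
      moreover have "prev src j u \<le> j"
        by (rule prev_le)
      moreover have "kahn_state (?D (prev src j u)) t'"
        using 1(1) unfolding ins by blast
      moreover have "tm t' + K * card D \<le> tm s + 3 + K * card (?D (prev src j u))"
        unfolding cd using 1(1) I(6) j(1) by (simp add: K_def)
      moreover have "vr s Back \<le> vr t' Back" "\<forall>i < vr s Back. queue t' i = queue s i"
        using 1(1) I(3,4) by simp_all
      ultimately show ?case
        unfolding e' using j(1,2) by simp
    qed
  next
    case (4 t)
    have fr: "vr t Front = Suc f"
      using frame_vr[OF 4(2), of Front] by (simp add: process_edge_def relax_def relax_slot_def)
    have e0: "vr t Edge = 0"
      using 4(3) by simp
    have q: "queue t i = queue s i" if "i < Suc f" for i
      using 4(1) f that by (simp add: f_def)
    have "queue t ` {..<Suc f} = queue s ` {..<Suc f}"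
      using q by (intro image_cong) auto
    also have "\<dots> = insert u (queue s ` {..<f})"
      by (auto simp: lessThan_Suc u_def)
    finally have "{j. j < e \<and> src j \<in> queue t ` {..<Suc f}} = ?D 0"
      by (auto simp: D f_def)
    then show ?case
      using 4(1) f by (simp add: fr e0 K_def f_def Let_def)
  qed
  moreover have "f < Q" "Suc f < Q" "u < Q" "0 < Q" "Suc 0 < Q"
    using f bn un Q_ge by (simp_all add: f_def)
  moreover have "ar s Queue f 0 = u" "ar s Head u 0 = prev src e u"
    using tb by (simp_all add: u_def queue_def tables_def)
  ultimately show ?thesis
    by (simp add: process_vertex_def f_def[symmetric])
qed

lemma wp_propagate:
  assumes tb: "tables s" and k: "kahn_state {} s"
  shows "wp propagate (\<lambda>t. kahn_state {..<e} t \<and> tm t \<le> tm s + 5 * n + (6 * w + 11) * e + 2) s"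
    (is "wp _ ?P s")
proof -
  let ?D = "\<lambda>t. {j. j < e \<and> src j \<in> queue t ` {..<vr t Front}}"
  have "wp (Loop (Var Front) (Var Back) process_vertex) ?P (upd Front 0 s)"
  proof (rule wp_Loop[where \<mu> = "\<lambda>t. n - vr t Front" and I = "\<lambda>t. vr t Front \<le> vr t Back
      \<and> kahn_state (?D t) t \<and> tm t \<le> tm s + 1 + 5 * vr t Front + (6 * w + 11) * card (?D t)"],
      goal_cases)
    case 1
    then show ?case
      using k by simp
  next
    case (2 t)
    then show ?case by simp
  next
    case (3 t)
    have tbt: "tables (tick t)"
      using tables_frame[OF 3(2)] tb
      by (simp add: process_vertex_def process_edge_def relax_def relax_slot_def tables_def sizes_def)
    \<comment> \<open>The queue holds distinct vertices, so it never exceeds \<open>n\<close>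
      entries; this bounds the number of iterations.\<close>
    have "vr t Front < n"
      using kahn_le[of "?D t"] 3 by force
    moreover have "wp process_vertex (\<lambda>t'. vr t' Front = Suc (vr (tick t) Front) \<and> vr t' Front \<le> vr t' Back
      \<and> (let D' = {j. j < e \<and> src j \<in> queue t' ` {..<vr t' Front}} in kahn_state D' t'
        \<and> tm t' + (6 * w + 11) * card (?D t) \<le> tm (tick t) + 4 + (6 * w + 11) * card D')) (tick t)"
      using 3 tbt by (intro wp_process_vertex) auto
    ultimately show ?case
      using 3(1) by (elim wp_mono) (auto simp: Let_def)
  next
    case (4 t)
    then have eq: "vr t Front = vr t Back"
      by simp
    \<comment> \<open>With the queue exhausted, every edge leaving a queued vertex is used, which is
      the hypothesis of \<open>kahn_complete\<close>.\<close>
    have D: "?D t = {..<e}"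
      using 4(1) by (intro kahn_complete[of "?D t" "ar t Mark" "degree t" "queue t" "vr t Back"])
        (auto simp: eq)
    have "vr t Back \<le> n"
      using 4(1) kahn_le by blast
    then show ?case
      using 4(1) unfolding D by (simp add: eq)
  qed
  then show ?thesis
    using Q8 by (simp add: propagate_def)
qed

lemma wp_scan:
  assumes tb: "tables s" and k: "kahn_state {..<e} s" and ans: "vr s Ans = 0"
  shows "wp scan (\<lambda>t. vr t Ans = (if has_match {..<n} edges lb T then 1 else 0)
    \<and> tm t \<le> tm s + 4 * n + 2) s"
    (is "wp _ ?P s")
proof -
  \<comment> \<open>Entries never exceed \<open>m\<close>, so a failing \<open><\<close> test
    against \<open>Len\<close> means equality.\<close>
  have le: "ar s Mark v (ch m) \<le> m" if "v < n" for v
    using k that by (simp add: kahn_def row_def)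
  have "wp (Loop (Var Ix) (Var NumV) scan_vertex) ?P (upd Ix 0 s)"
  proof (rule wp_Loop[where \<mu> = "\<lambda>t. n - vr t Ix" and I = "\<lambda>t. vr t Ix \<le> n
      \<and> vr t Ans = (if \<exists>v < vr t Ix. ar s Mark v (ch m) = m then 1 else 0)
      \<and> tm t \<le> tm s + 1 + 4 * vr t Ix"], goal_cases)
    case (3 t)
    have tbt: "tables t"
      using tables_frame[OF 3(2)] tb by (simp add: scan_vertex_def tables_def sizes_def)
    have "ar t Mark = ar s Mark"
      using frame_ar[OF 3(2)] by (simp add: scan_vertex_def)
    then show ?case
      using 3 tbt le[of "vr t Ix"] state_bounds[of m] Q_ge
      by (auto simp: scan_vertex_def tables_def sizes_def less_Suc_eq)
  next
    case (4 t)
    have "tables t"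
      using tables_frame[OF 4(2)] tb by (simp add: scan_vertex_def tables_def sizes_def)
    then show ?case
      using 4 kahn_has_match[OF k] by (auto simp: tables_def sizes_def)
  qed (use ans in simp_all)
  then show ?thesis
    using Q8 by (simp add: scan_def)
qed

end

section \<open>The complete algorithm and its total running time\<close>

context matching
begin

abbreviation "total_time \<equiv> 27 * ((n + e) * failure_width T + \<sigma> * m) + 27"

text \<open>Width and alphabet size are positive, so the linear terms are absorbed into the products
  with total coefficients 16, 24 and 18. The constant 27 is the sum of the additive constants of the
  stages and dominates these.\<close>

lemma total_time_bound:
  "16 * n + 7 * e + (6 * failure_width T + 11) * e + m * (3 * \<sigma> + 9) + 6 * m + 27 \<le> total_time"
proof -
  have m: "0 < m"
    using T_nonempty by simp
  then have "1 \<le> \<sigma>"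
    using symbol_less[OF m] by simp
  then have le: "m \<le> \<sigma> * m" "n \<le> n * failure_width T" "e \<le> e * failure_width T"
    using failure_width_pos[of T] by simp_all
  have eqs: "(6 * failure_width T + 11) * e = 6 * (e * failure_width T) + 11 * e"
    "m * (3 * \<sigma> + 9) = 3 * (\<sigma> * m) + 9 * m"
    "(n + e) * failure_width T = n * failure_width T + e * failure_width T"
    by (simp_all add: algebra_simps)
  have "16 * n + 7 * e + (6 * z + 11 * e) + (3 * x + 9 * m) + 6 * m + 27 \<le> 27 * (y + z + x) + 27"
    if "m \<le> x" "n \<le> y" "e \<le> z" for x y z
    using that by simp
  then show ?thesis
    unfolding eqs using le .
qed

lemma wp_matcher:
  "wp matcher (\<lambda>s. vr s Ans = (if has_match {..<n} edges lb T then 1 else 0) \<and> tm s \<le> total_time)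
     blank"
  (is "wp _ ?P _")
proof -
  define s0 where "s0 = tick (upd Len m (upd NumA \<sigma> (upd NumE e (upd NumV n blank))))"
  have s0: "sizes s0" "ar s0 = (\<lambda>_ _ _. 0)" "vr s0 Ans = 0" "tm s0 = 5"
    by (simp_all add: s0_def sizes_def blank_def)
  let ?tail = "init_vertices ;; propagate ;; scan"
  have stage3: "wp ?tail ?P s3"
    if sz: "sizes s3" and ans: "vr s3 Ans = 0" and mark: "ar s3 Mark = (\<lambda>_ _. 0)"
      and hd: "\<forall>u. ar s3 Head u 0 = prev src e u"
      and nx: "\<forall>j < e. ar s3 Next (Suc j) 0 = prev src j (src j)"
      and dg: "\<forall>v. ar s3 Deg v 0 = card {j. j < e \<and> dst j = v}"
      and dl: "\<forall>i \<le> m. \<forall>a < \<sigma>. ar s3 Delta i a = delta T i a"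
      and col: "colouring T 0 (\<lambda>k. ar s3 Chain k 0) (vr s3 Wid)"
      and tm: "tm s3 \<le> 7 * e + m * (3 * \<sigma> + 9) + 6 * m + 20" for s3
  proof -
    \<comment> \<open>The colouring exists only once the preprocessing has run, so the locale is
      instantiated here with the colours found in the store.\<close>
    define ch w where "ch = (\<lambda>k. ar s3 Chain k 0)" and "w = failure_width T"
    have w: "vr s3 Wid = w"
      using col by (simp add: colouring_def w_def failure_width_leaf)
    interpret coloured_matching W Q inp n e src dst lb T \<sigma> ch w
    proof
      show "chain_colours T ch"
        using col by (simp add: colouring_def ch_def)
      have "\<forall>k \<le> m. ar s3 Chain k 0 \<le> vr s3 Wid" "\<forall>k \<in> {0..m}. 0 < ar s3 Chain k 0"
        using col unfolding colouring_def by - (elim conjE, assumption)+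
      then show "0 < ch k" "ch k \<le> w" if "k \<le> m" for k
        using that w by (simp_all add: ch_def)
      show "w \<le> Suc m"
        by (simp add: w_def failure_width_le)
    qed
    have tb: "tables s3"
      using sz w dl hd nx unfolding tables_def by (simp add: ch_def)
    have "\<forall>v. degree s3 v = card {j. j < e \<and> dst j = v}"
      using dg by (simp add: degree_def)
    from wp_init_vertices[OF tb mark this] have "wp init_vertices (wp (propagate ;; scan) ?P) s3"
    proof (rule wp_mono)
      fix s4 assume 4: "kahn_state {} s4 \<and> tm s4 \<le> tm s3 + 7 * n + 3" and fr4: "frame init_vertices s3 s4"
      have tb4: "tables s4"
        using tables_frame[OF fr4] tb by (simp add: init_vertices_def init_vertex_def)
      have ans4: "vr s4 Ans = 0"
        using frame_vr[OF fr4, of Ans] ans by (simp add: init_vertices_def init_vertex_def)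
      have "kahn_state {} s4"
        using 4 by blast
      from wp_propagate[OF tb4 this] have "wp propagate (wp scan ?P) s4"
      proof (rule wp_mono)
        fix s5 assume 5: "kahn_state {..<e} s5 \<and> tm s5 \<le> tm s4 + 5 * n + (6 * w + 11) * e + 2"
          and fr5: "frame propagate s4 s5"
        have tb5: "tables s5"
          using tables_frame[OF fr5] tb4
          by (simp add: propagate_def process_vertex_def process_edge_def relax_def relax_slot_def)
        have ans5: "vr s5 Ans = 0"
          using frame_vr[OF fr5, of Ans] ans4
          by (simp add: propagate_def process_vertex_def process_edge_def relax_def relax_slot_def)
        have "kahn_state {..<e} s5"
          using 5 by blast
        from wp_scan[OF tb5 this ans5] show "wp scan ?P s5"
        proof (rule wp_mono)
          fix s6 :: store assume 6: "vr s6 Ans = (if has_match {..<n} edges lb T then 1 else 0)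
            \<and> tm s6 \<le> tm s5 + 4 * n + 2"
          have "tm s6 \<le> total_time"
            using total_time_bound tm 4 5 6 unfolding w_def by linarith
          then show "?P s6"
            using 6 by blast
        qed
      qed
      then show "wp (propagate ;; scan) ?P s4"
        by simp
    qed
    then show ?thesis
      by simp
  qed
  have "ar s0 Head = (\<lambda>_ _. 0)" "ar s0 Deg = (\<lambda>_ _. 0)"
    by (simp_all add: s0(2))
  from wp_link_edges[OF s0(1) this]
  have "wp link_edges (wp (build_automaton ;; colour_states ;; ?tail) ?P) s0"
  proof (rule wp_mono)
    fix s1 assume 1: "(\<forall>u. ar s1 Head u 0 = prev src e u)
      \<and> (\<forall>j < e. ar s1 Next (Suc j) 0 = prev src j (src j))
      \<and> (\<forall>v. ar s1 Deg v 0 = card {j. j < e \<and> dst j = v})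
      \<and> tm s1 \<le> tm s0 + 7 * e + 2" and fr1: "frame link_edges s0 s1"
    have sz1: "sizes s1"
      using sizes_frame[OF fr1] s0(1) by (simp add: link_edges_def link_edge_def)
    have z1: "ar s1 Delta = (\<lambda>_ _. 0)" "ar s1 Fail = (\<lambda>_ _. 0)" "ar s1 Chain = (\<lambda>_ _. 0)"
      "ar s1 Mark = (\<lambda>_ _. 0)" "vr s1 Ans = 0"
      using frame_ar[OF fr1] frame_vr[OF fr1] s0 by (simp_all add: link_edges_def link_edge_def)
    from wp_build_automaton[OF sz1 z1(1,2)]
    have "wp build_automaton (wp (colour_states ;; ?tail) ?P) s1"
    proof (rule wp_mono)
      fix s2 assume 2: "(\<forall>i \<le> m. \<forall>a < \<sigma>. ar s2 Delta i a = delta T i a)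
        \<and> (\<forall>i. 1 \<le> i \<longrightarrow> i \<le> m \<longrightarrow> ar s2 Fail i 0 = failure T i) \<and> ar s2 Fail 0 0 = 0
        \<and> tm s2 \<le> tm s1 + m * (3 * \<sigma> + 9) + 4" and fr2: "frame build_automaton s1 s2"
      note defs2 = build_automaton_def next_row_def copy_row_def
      have sz2: "sizes s2"
        using sizes_frame[OF fr2] sz1 by (simp add: defs2)
      have z2: "ar s2 Chain = (\<lambda>_ _. 0)" "ar s2 Mark = (\<lambda>_ _. 0)" "vr s2 Ans = 0"
        "ar s2 Head = ar s1 Head" "ar s2 Next = ar s1 Next" "ar s2 Deg = ar s1 Deg"
        using frame_ar[OF fr2] frame_vr[OF fr2] z1 by (simp_all add: defs2)
      have "\<forall>i. 1 \<le> i \<longrightarrow> i \<le> m \<longrightarrow> ar s2 Fail i 0 = failure T i" "ar s2 Fail 0 0 = 0"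
        using 2 by blast+
      from wp_colour_states[OF sz2 z2(1) this] have "wp colour_states (wp ?tail ?P) s2"
      proof (rule wp_mono)
        fix s3 assume 3: "colouring T 0 (\<lambda>k. ar s3 Chain k 0) (vr s3 Wid) \<and> tm s3 \<le> tm s2 + 6 * m + 9"
          and fr3: "frame colour_states s2 s3"
        note defs3 = colour_states_def colour_state_def
        have "sizes s3"
          using sizes_frame[OF fr3] sz2 by (simp add: defs3)
        moreover have "ar s3 Mark = (\<lambda>_ _. 0)" "vr s3 Ans = 0"
          "ar s3 Head = ar s1 Head" "ar s3 Next = ar s1 Next" "ar s3 Deg = ar s1 Deg"
          "ar s3 Delta = ar s2 Delta"
          using frame_ar[OF fr3] frame_vr[OF fr3] z2 by (simp_all add: defs3)
        moreover have "tm s3 \<le> 7 * e + m * (3 * \<sigma> + 9) + 6 * m + 20"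
          using 1 2 3 s0(4) by linarith
        ultimately show "wp ?tail ?P s3"
          using 1 2 3 by (intro stage3) simp_all
      qed
      then show "wp (colour_states ;; ?tail) ?P s2"
        by simp
    qed
    then show "wp (build_automaton ;; colour_states ;; ?tail) ?P s1"
      by simp
  qed
  moreover have "0 < m"
    using T_nonempty by simp
  ultimately show ?thesis
    using Q8 inp_sizes by (simp add: matcher_def s0_def)
qed

end

lemma (in machine) wp_matcher_empty:
  assumes "inp 3 = 0"
  shows "wp matcher (\<lambda>s. vr s Ans = 1 \<and> tm s \<le> 27) blank"
  using Q8 assms by (simp add: matcher_def blank_def)

section \<open>Renaming vertices and symbols\<close>

lemma position_nth: "distinct xs \<Longrightarrow> i < length xs \<Longrightarrow> position xs (xs ! i) = i"
  unfolding position_def by (rule the_equality) (auto simp: nth_eq_iff_index_eq)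

lemma position_in:
  assumes "distinct xs" "x \<in> set xs"
  shows "position xs x < length xs" "xs ! position xs x = x"
  using assms position_nth[OF assms(1)] by (auto simp: in_set_conv_nth)

lemma inj_on_position: "distinct xs \<Longrightarrow> inj_on (position xs) (set xs)"
  by (rule inj_on_inverseI[of _ "nth xs"]) (rule position_in)

lemma suffix_map_iff:
  assumes "inj_on f (set x \<union> set y)"
  shows "suffix (map f x) (map f y) \<longleftrightarrow> suffix x y"
proof
  assume "suffix (map f x) (map f y)"
  then obtain z where z: "map f y = z @ map f x"
    by (auto simp: suffix_def)
  have "map f (drop (length z) y) = drop (length z) (map f y)"
    by (simp add: drop_map)
  also have "\<dots> = map f x"
    by (simp add: z)
  finally have "drop (length z) y = x"
    using assms by (elim map_inj_on) (auto simp: inj_on_def dest: in_set_dropD)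
  then show "suffix x y"
    using suffix_drop by metis
qed (rule map_mono_suffix)

text \<open>The width depends only on the suffix order between prefixes, which an injective renaming
  of symbols preserves.\<close>

lemma failure_width_map:
  assumes "inj_on f (set S)"
  shows "failure_width (map f S) = failure_width S"
proof -
  have "sfx (map f S) k i \<longleftrightarrow> sfx S k i" for k i
    unfolding sfx_def take_map
    by (rule suffix_map_iff) (use assms in \<open>auto simp: inj_on_def dest: in_set_takeD\<close>)
  then have "failure (map f S) j = failure S j" if "j \<le> length S" for j
    using that by (simp add: failure_eq)
  then show ?thesis
    unfolding failure_width_def by (auto intro!: arg_cong[of _ _ card])
qed

lemma concat_pairs_nth:
  assumes "j < length xs"
  shows "concat (map (\<lambda>(u, v). [f u, f v]) xs) ! (j + j) = f (fst (xs ! j))"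
    "concat (map (\<lambda>(u, v). [f u, f v]) xs) ! Suc (j + j) = f (snd (xs ! j))"
  using assms
proof (induction xs arbitrary: j)
  case (Cons x xs)
  {
    case 1
    then show ?case
      using Cons.IH(1)[of "j - 1"] by (cases j) (auto split: prod.splits)
  next
    case 2
    then show ?case
      using Cons.IH(2)[of "j - 1"] by (cases j) (auto split: prod.splits)
  }
qed simp_all

lemma length_concat_pairs: "length (concat (map (\<lambda>(u, v). [f u, f v]) xs)) = 2 * length xs"
  by (induction xs) auto

section \<open>An arbitrary instance as an instance on numbers\<close>

locale encoded_graph =
  fixes V :: "'v set" and E :: "('v \<times> 'v) set" and \<Sigma> :: "'a set" and lab :: "'v \<Rightarrow> 'a"
    and S :: "'a list" and vs es as
  assumes dag: "dag V E" and labels: "lab ` V \<subseteq> \<Sigma>" and word: "S \<in> lists \<Sigma>"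
    and vs: "listing vs V" and es: "listing es E" and "as": "listing as \<Sigma>"
begin

definition "src j = position vs (fst (es ! j))"
definition "dst j = position vs (snd (es ! j))"
definition "lb v = position as (lab (vs ! v))"
definition "T = map (position as) S"

lemma distinct: "distinct vs" "distinct es" "distinct as"
  and sets: "set vs = V" "set es = E" "set as = \<Sigma>"
  using vs es "as" by (simp_all add: listing_def)

lemma edge_in: "j < length es \<Longrightarrow> es ! j \<in> E" "(u, v) \<in> E \<Longrightarrow> u \<in> V \<and> v \<in> V"
  using sets dag by (auto simp: dag_def)

lemma src_dst:
  assumes "j < length es"
  shows "src j < length vs" "dst j < length vs" "(vs ! src j, vs ! dst j) = es ! j"
proof -
  obtain u v where uv: "es ! j = (u, v)"
    by fastforce
  then have "u \<in> V" "v \<in> V"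
    using edge_in(1)[of j] edge_in(2)[of u v] assms by auto
  then show "src j < length vs" "dst j < length vs" "(vs ! src j, vs ! dst j) = es ! j"
    using position_in[OF distinct(1)] sets(1) by (auto simp: src_def dst_def uv)
qed

abbreviation "arcs \<equiv> (\<lambda>j. (src j, dst j)) ` {..<length es}"

lemma arcs_nth: "(x, y) \<in> arcs \<Longrightarrow> (vs ! x, vs ! y) \<in> E"
  using src_dst(3) edge_in(1) by auto

lemma arcs_position: "(u, v) \<in> E \<Longrightarrow> (position vs u, position vs v) \<in> arcs"
  using sets(2) by (force simp: in_set_conv_nth src_def dst_def image_iff)

lemma acyclic_arcs: "acyclic arcs"
proof -
  have "(x, y) \<in> arcs\<^sup>+ \<Longrightarrow> (vs ! x, vs ! y) \<in> E\<^sup>+" for x y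
  proof (induction rule: trancl_induct)
    case (base y)
    then show ?case
      using arcs_nth by blast
  next
    case (step y z)
    then show ?case
      using arcs_nth by (meson trancl.trancl_into_trancl)
  qed
  then show ?thesis
    using dag unfolding acyclic_def dag_def by blast
qed

lemma label_in: "v < length vs \<Longrightarrow> lab (vs ! v) \<in> set as"
  using labels sets by (metis image_subset_iff nth_mem)

lemma has_match_renamed: "has_match {..<length vs} arcs lb T \<longleftrightarrow> has_match V E lab S"
proof
  assume "has_match {..<length vs} arcs lb T"
  then obtain p where p: "set p \<subseteq> {..<length vs}" "distinct p"
      "successively (\<lambda>u v. (u, v) \<in> arcs) p" "map lb p = T"
    by (auto simp: has_match_def path_def)
  let ?q = "map (nth vs) p"
  have "set ?q \<subseteq> V"
    using p(1) sets(1) nth_mem by fastforce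
  moreover have "distinct ?q"
    using p(1,2) distinct(1) by (auto simp: distinct_map intro!: inj_on_nth)
  moreover have "successively (\<lambda>u v. (u, v) \<in> E) ?q"
    unfolding successively_map by (rule successively_mono[OF p(3)]) (rule arcs_nth)
  moreover have "map lab ?q = S"
  proof (rule map_inj_on[of "position as"])
    show "map (position as) (map lab ?q) = map (position as) S"
      using p(4) by (simp add: T_def lb_def[abs_def] o_def)
    have "set (map lab ?q) \<subseteq> set as"
      using p(1) label_in by auto
    moreover have "set S \<subseteq> set as"
      using word sets by auto
    ultimately show "inj_on (position as) (set (map lab ?q) \<union> set S)"
      using inj_on_subset[OF inj_on_position[OF distinct(3)]] by simp
  qed
  ultimately show "has_match V E lab S"
    unfolding has_match_def path_def by blast
next
  assume "has_match V E lab S"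
  then obtain p where p: "set p \<subseteq> V" "distinct p" "successively (\<lambda>u v. (u, v) \<in> E) p" "map lab p = S"
    by (auto simp: has_match_def path_def)
  let ?q = "map (position vs) p"
  have pos: "position vs v < length vs" "vs ! position vs v = v" if "v \<in> set p" for v
    using position_in[OF distinct(1), of v] sets(1) that p(1) by auto
  have "set ?q \<subseteq> {..<length vs}"
    using pos by auto
  moreover have "distinct ?q"
    using p(2) inj_on_subset[OF inj_on_position[OF distinct(1)]] p(1) sets(1) by (simp add: distinct_map)
  moreover have "successively (\<lambda>u v. (u, v) \<in> arcs) ?q"
    unfolding successively_map by (rule successively_mono[OF p(3)]) (rule arcs_position)
  moreover have "map lb ?q = T"
    using p(4) pos by (auto simp: lb_def T_def)
  ultimately show "has_match {..<length vs} arcs lb T"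
    unfolding has_match_def path_def by blast
qed

lemma failure_width_renamed: "failure_width T = failure_width S"
proof -
  have "set S \<subseteq> set as"
    using word sets by auto
  then show ?thesis
    unfolding T_def using inj_on_subset[OF inj_on_position[OF distinct(3)]]
    by (intro failure_width_map) blast
qed

abbreviation "input \<equiv> encode vs es as lab S"

definition "inp i = (if i < length input then input ! i else 0)"

lemma length_input: "length input = 4 + length vs + 2 * length es + length S"
  using length_concat_pairs[of "position vs" es] by (simp add: encode_def)

lemma inp_parts:
  "inp 0 = length vs" "inp 1 = length es" "inp 2 = length as" "inp 3 = length S"
  "v < length vs \<Longrightarrow> inp (4 + v) = lb v"
  "j < length es \<Longrightarrow> inp (4 + length vs + (j + j)) = src j"
  "j < length es \<Longrightarrow> inp (5 + length vs + (j + j)) = dst j"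
  "i < length S \<Longrightarrow> inp (4 + length vs + (length es + length es + i)) = T ! i"
proof -
  let ?L = "map (\<lambda>v. position as (lab v)) vs"
  let ?C = "concat (map (\<lambda>(u, v). [position vs u, position vs v]) es)"
  let ?S = "map (position as) S"
  have C: "length ?C = length es + length es"
    using length_concat_pairs[of "position vs" es] by simp
  have inp: "inp i = ([length vs, length es, length as, length S] @ ?L @ ?C @ ?S) ! i"
    if "i < 4 + length vs + 2 * length es + length S" for i
    using that length_input by (simp add: inp_def encode_def)
  have shift: "inp (4 + i) = (?L @ ?C @ ?S) ! i" if "i < length vs + 2 * length es + length S" for i
    using that by (subst inp) (auto simp: nth_append)
  have shift2: "inp (4 + length vs + i) = (?C @ ?S) ! i" if "i < 2 * length es + length S" for i
    using that shift[of "length vs + i"] by (simp add: nth_append add.assoc)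
  show "inp 0 = length vs" "inp 1 = length es" "inp 2 = length as" "inp 3 = length S"
    by (simp_all add: inp)
  show "inp (4 + v) = lb v" if "v < length vs"
    using that by (subst shift) (simp_all add: nth_append lb_def)
  show "inp (4 + length vs + (j + j)) = src j" if "j < length es"
    using that concat_pairs_nth(1)[OF that, of "position vs"] C
    by (subst shift2) (simp_all add: nth_append src_def)
  have "inp (4 + length vs + Suc (j + j)) = dst j" if "j < length es"
    using that concat_pairs_nth(2)[OF that, of "position vs"] C
    by (subst shift2) (simp_all add: nth_append dst_def)
  then show "inp (5 + length vs + (j + j)) = dst j" if "j < length es"
    using that by (simp add: eval_nat_numeral)
  show "inp (4 + length vs + (length es + length es + i)) = T ! i" if "i < length S"
    using that C by (subst shift2) (simp_all add: nth_append T_def)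
qed

text \<open>Origin of the exponent 11: \<open>Q <= 4 * N\<close> and \<open>2 <= N\<close> give
  \<open>Q * Q * Q <= 2 ^ 6 * N ^ 3 <= N ^ 9\<close>. Adding \<open>Q <= N ^ 9\<close> stays below
  \<open>4 * N ^ 9 <= N ^ 11\<close>.\<close>

lemma answers:
  assumes W: "(length vs + length es + length as + length S + 2) ^ 11 \<le> 2 ^ W"
  shows "answers_within W (program matcher) input (has_match V E lab S)
    (length prelude + length (program matcher) *
      (27 * ((length vs + length es) * failure_width S + length as * length S) + 27))"
proof -
  define N Q where "N = length vs + length es + length as + length S + 2"
    and "Q = length vs + 2 * length es + length as + length S + 8"
  have N2: "2 \<le> N" and QN: "Q \<le> 4 * N"
    by (simp_all add: N_def Q_def)
  have "Q * Q * Q \<le> (4 * N) * (4 * N) * (4 * N)"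
    using QN by (intro mult_le_mono)
  also have "\<dots> = 2 ^ 6 * N ^ 3"
    by (simp add: power3_eq_cube)
  also have "\<dots> \<le> N ^ 6 * N ^ 3"
    using N2 by (intro mult_le_mono1 power_mono) auto
  finally have 1: "Q * Q * Q \<le> N ^ 9"
    by (simp add: power_add[symmetric])
  have "Q \<le> 2 ^ 2 * N"
    using QN by simp
  also have "\<dots> \<le> N ^ 8 * N"
    using N2 power_mono[of 2 N 2] power_increasing[of 2 8 N] by (intro mult_le_mono1) linarith
  finally have 2: "Q \<le> N ^ 9"
    by (simp add: power_Suc2[symmetric] del: power_Suc)
  have "0 < N ^ 9"
    using N2 by simp
  then have "N ^ 9 + N ^ 9 < N ^ 9 * 2 ^ 2"
    by simp
  also have "\<dots> \<le> N ^ 9 * N ^ 2"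
    using N2 by (intro mult_le_mono2 power_mono) auto
  also have "\<dots> = N ^ 11"
    by (simp add: power_add[symmetric])
  also have "\<dots> \<le> 2 ^ W"
    using W by (simp add: N_def)
  finally have fits: "Q * Q * Q + Q < 2 ^ W"
    using 1 2 by linarith
  interpret machine W Q inp
    using fits by unfold_locales (simp_all add: Q_def)
  have "wp matcher (\<lambda>s. vr s Ans = (if has_match V E lab S then 1 else 0) \<and>
      tm s \<le> 27 * ((length vs + length es) * failure_width S + length as * length S) + 27) blank"
  proof (cases "S = []")
    case True
    have "path V E []"
      by (simp add: path_def)
    then have "has_match V E lab S"
      using True by (auto simp: has_match_def)
    moreover have "inp 3 = 0"
      using inp_parts(4) True by simp
    ultimately show ?thesis
      by (auto intro: wp_mono[OF wp_matcher_empty])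
  next
    case False
    have lenT: "length T = length S"
      by (simp add: T_def)
    interpret matching W Q inp "length vs" "length es" src dst lb T "length as"
    proof
      show "T \<noteq> []"
        using False by (simp add: T_def)
      show "lb v < length as" if "v < length vs" for v
        using position_in(1)[OF distinct(3) label_in[OF that]] by (simp add: lb_def)
      show "T ! i < length as" if "i < length T" for i
      proof -
        have "S ! i \<in> set as"
          using that word sets(3) by (auto simp: lenT)
        then show ?thesis
          using position_in(1)[OF distinct(3)] that by (simp add: T_def)
      qed
    qed (use src_dst acyclic_arcs inp_parts in \<open>simp_all add: lenT Q_def\<close>)
    show ?thesis
      using wp_matcher unfolding edges_def has_match_renamed failure_width_renamed lenT .
  qed
  then show ?thesis
  proof (rule program_answers)
    show "inp i = (if i < length input then input ! i else 0)" for i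
      by (rule inp_def)
    show "Q = inp 0 + 2 * inp 1 + inp 2 + inp 3 + 8"
      by (simp only: inp_parts(1-4) Q_def)
    show "length input \<le> Q"
      by (simp add: length_input Q_def)
  qed
qed

end

theorem theorem28:
  "\<exists>(P :: instr list) (c :: nat) (d :: nat).
     \<forall>(V :: 'v set) (E :: ('v \<times> 'v) set) (\<Sigma> :: 'a set) (lab :: 'v \<Rightarrow> 'a) (S :: 'a list)
       vs es as (W :: nat).
       dag V E \<and> finite \<Sigma> \<and> lab ` V \<subseteq> \<Sigma> \<and> S \<in> lists \<Sigma> \<and>
       listing vs V \<and> listing es E \<and> listing as \<Sigma> \<and>
       (card V + card E + card \<Sigma> + length S + 2) ^ d \<le> 2 ^ W
       \<longrightarrow> answers_within W P (encode vs es as lab S) (has_match V E lab S)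
             (c * ((card V + card E) * failure_width S + card \<Sigma> * length S) + c)"
proof (intro exI allI impI, elim conjE)
  let ?P = "program matcher"
  \<comment> \<open>The prelude is paid once; the factor 27 comes from the clock bound and
    \<open>length ?P\<close> from the machine steps per tick.\<close>
  let ?c = "length prelude + 27 * length ?P"
  fix V :: "'v set" and E :: "('v \<times> 'v) set" and \<Sigma> :: "'a set" and lab :: "'v \<Rightarrow> 'a"
    and S :: "'a list" and vs es as and W :: nat
  assume "dag V E" "finite \<Sigma>" "lab ` V \<subseteq> \<Sigma>" "S \<in> lists \<Sigma>"
    and lst: "listing vs V" "listing es E" "listing as \<Sigma>"
    and W: "(card V + card E + card \<Sigma> + length S + 2) ^ 11 \<le> 2 ^ W"
  then interpret encoded_graph V E \<Sigma> lab S vs es as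
    by unfold_locales
  have len: "length vs = card V" "length es = card E" "length as = card \<Sigma>"
    using lst by (auto simp: listing_def distinct_card)
  let ?x = "(card V + card E) * failure_width S + card \<Sigma> * length S"
  have "answers_within W ?P (encode vs es as lab S) (has_match V E lab S)
      (length prelude + length ?P * (27 * ?x + 27))"
    using answers[of W] W unfolding len by blast
  moreover have "length prelude + length ?P * (27 * ?x + 27) \<le> ?c * ?x + ?c"
    by (simp add: algebra_simps)
  ultimately show "answers_within W ?P (encode vs es as lab S) (has_match V E lab S) (?c * ?x + ?c)"
    unfolding answers_within_def using order.trans by blast
qed

end
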